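(* Let $\Omega$ be an open subset of $\mathbb{R}^n$, $n\ge 3$, and let $e$ be the Euclidean metric. The limiting Carleman weights $\varphi$ in $(\Omega,e)$ are locally (that is, in a neighbourhood of each point of $\Omega$) of the form $$\varphi(x)=a\,\varphi_0(x-x_0)+b,$$ where $a\in\mathbb{R}\setminus\{0\}$, $b\in\mathbb{R}$, $x_0\in\mathbb{R}^n$, and $\varphi_0$ is one of the following functions: $$\langle x,\xi\rangle,\qquad \arg\langle x,\omega_1+i\omega_2\rangle,\qquad \log|x|,\qquad \frac{\langle x,\xi\rangle}{|x|^2},\qquad \arg\big(e^{i\theta}(x+i\xi)^2\big),\qquad \log\frac{|x+\xi|^2}{|x-\xi|^2},$$ with $\omega_1,\omega_2\in\mathbb{R}^n$ orthogonal unit vectors, $\theta\in[0,2\pi)$ and $\xi\in\mathbb{R}^n\setminus\{0\}$.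
   Context: For a smooth real-valued function $\varphi$ on a Riemannian manifold $(M,g)$ define on $T^*M$ $$p_\varphi(x,\xi)=|\xi|^2-|d\varphi|^2+2i\langle \xi,d\varphi\rangle$$ (the semiclassical principal symbol of $e^{\varphi/h}(-h^2\Delta_g)e^{-\varphi/h}$). On a manifold without boundary none of whose components is compact, a smooth real-valued function $\varphi$ is a limiting Carleman weight if $d\varphi$ vanishes nowhere and the Poisson bracket $\{\overline{p_\varphi},p_\varphi\}$ vanishes at every point of $T^*M$ where $p_\varphi=0$. Here $\langle\cdot,\cdot\rangle$ is extended complex-bilinearly, so $\langle x,\omega_1+i\omega_2\rangle=\langle x,\omega_1\rangle+i\langle x,\omega_2\rangle$, and for $\zeta\in\mathbb{C}^n$, $\zeta^2=\langle\zeta,\zeta\rangle$, so $(x+i\xi)^2=|x|^2-|\xi|^2+2i\langle x,\xi\rangle$. The argument is $$\arg z=2\arctan\frac{\operatorname{Im} z}{|z|+\operatorname{Re} z},\qquad z\in\mathbb{C}\setminus\mathbb{R}_-,\quad \mathbb{R}_-=(-\infty,0].$$ *)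

theory Defs
  imports "HOL-Analysis.Analysis"
begin

text \<open>The covector \<open>d\<phi>\<close> at \<open>x\<close>, identified with the vector of partial derivatives.\<close>

definition diff_covec :: "(real^'n \<Rightarrow> real) \<Rightarrow> real^'n \<Rightarrow> real^'n" where
  "diff_covec \<phi> x = (\<chi> j. frechet_derivative \<phi> (at x) (axis j 1))"

text \<open>Intended for open \<open>S\<close>. Functions are total, but only their values on \<open>S\<close> matter.\<close>

primrec Ck_on :: "nat \<Rightarrow> (real^'n) set \<Rightarrow> (real^'n \<Rightarrow> real) \<Rightarrow> bool" where
  "Ck_on 0 S f \<longleftrightarrow> continuous_on S f"
| "Ck_on (Suc k) S f \<longleftrightarrow>
     f differentiable_on S \<and> (\<forall>j. Ck_on k S (\<lambda>x. frechet_derivative f (at x) (axis j 1)))"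

definition smooth_on :: "(real^'n) set \<Rightarrow> (real^'n \<Rightarrow> real) \<Rightarrow> bool" where
  "smooth_on S f \<longleftrightarrow> (\<forall>k. Ck_on k S f)"

definition symbol :: "(real^'n \<Rightarrow> real) \<Rightarrow> (real^'n) \<times> (real^'n) \<Rightarrow> complex" where
  "symbol \<phi> = (\<lambda>(x, \<xi>).
     of_real ((norm \<xi>)\<^sup>2 - (norm (diff_covec \<phi> x))\<^sup>2) + 2 * \<i> * of_real (\<xi> \<bullet> diff_covec \<phi> x))"

text \<open>The canonical Poisson bracket
  \<open>{f, g} = \<Sum>\<^sub>j (\<partial>f/\<partial>\<xi>\<^sub>j \<partial>g/\<partial>x\<^sub>j - \<partial>f/\<partial>x\<^sub>j \<partial>g/\<partial>\<xi>\<^sub>j)\<close>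
  on the cotangent bundle, whose points are pairs \<open>(x, \<xi>)\<close>.\<close>

definition poisson_bracket ::
  "((real^'n) \<times> (real^'n) \<Rightarrow> complex) \<Rightarrow> ((real^'n) \<times> (real^'n) \<Rightarrow> complex)
     \<Rightarrow> (real^'n) \<times> (real^'n) \<Rightarrow> complex" where
  "poisson_bracket f g z = (\<Sum>j\<in>UNIV.
       frechet_derivative f (at z) (0, axis j 1) * frechet_derivative g (at z) (axis j 1, 0)
     - frechet_derivative f (at z) (axis j 1, 0) * frechet_derivative g (at z) (0, axis j 1))"

text \<open>For open \<open>\<Omega>\<close> with the Euclidean metric; no component of such a set is compact.\<close>

definition limiting_carleman_weight :: "(real^'n) set \<Rightarrow> (real^'n \<Rightarrow> real) \<Rightarrow> bool" where
  "limiting_carleman_weight \<Omega> \<phi> \<longleftrightarrow>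
     smooth_on \<Omega> \<phi> \<and>
     (\<forall>x\<in>\<Omega>. diff_covec \<phi> x \<noteq> 0) \<and>
     (\<forall>x\<in>\<Omega>. \<forall>\<xi>. symbol \<phi> (x, \<xi>) = 0 \<longrightarrow>
        poisson_bracket (\<lambda>z. cnj (symbol \<phi> z)) (symbol \<phi>) (x, \<xi>) = 0)"

text \<open>The vector \<open>x + i y\<close>, and the complex-bilinear (not Hermitian) extension of the
  Euclidean inner product.\<close>

definition cvec :: "real^'n \<Rightarrow> real^'n \<Rightarrow> complex^'n" where
  "cvec x y = (\<chi> j. Complex (x $ j) (y $ j))"

definition cdot :: "complex^'n \<Rightarrow> complex^'n \<Rightarrow> complex" where
  "cdot z w = (\<Sum>j\<in>UNIV. z $ j * w $ j)"

lemma cdot_real_left: "cdot (cvec x 0) (cvec y z) = Complex (x \<bullet> y) (x \<bullet> z)"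
  by (simp add: cdot_def cvec_def inner_vec_def complex_eq_iff)

lemma cdot_cvec_self:
  "cdot (cvec x y) (cvec x y) = Complex ((norm x)\<^sup>2 - (norm y)\<^sup>2) (2 * (x \<bullet> y))"
  unfolding power2_norm_eq_inner
  by (simp add: cdot_def cvec_def inner_vec_def complex_eq_iff sum_subtractf sum.distrib
      sum_distrib_left mult.commute)

text \<open>The branch of the argument on the complement of \<open>\<real>\<^sub>\<le>\<^sub>0\<close>; only used there.\<close>

definition arg :: "complex \<Rightarrow> real" where
  "arg z = 2 * arctan (Im z / (norm z + Re z))"

text \<open>\<open>model_weight \<phi>\<^sub>0 D\<close>: \<open>\<phi>\<^sub>0\<close> is one of the model functions and \<open>D\<close> its natural domain.\<close>

inductive model_weight :: "(real^'n \<Rightarrow> real) \<Rightarrow> (real^'n) set \<Rightarrow> bool" where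
  linear: "\<xi> \<noteq> 0 \<Longrightarrow> model_weight (\<lambda>x. x \<bullet> \<xi>) UNIV"
| arg_linear: "norm \<omega>\<^sub>1 = 1 \<Longrightarrow> norm \<omega>\<^sub>2 = 1 \<Longrightarrow> \<omega>\<^sub>1 \<bullet> \<omega>\<^sub>2 = 0 \<Longrightarrow>
     model_weight (\<lambda>x. arg (cdot (cvec x 0) (cvec \<omega>\<^sub>1 \<omega>\<^sub>2)))
       {x. cdot (cvec x 0) (cvec \<omega>\<^sub>1 \<omega>\<^sub>2) \<notin> \<real>\<^sub>\<le>\<^sub>0}"
| log_norm: "model_weight (\<lambda>x. ln (norm x)) (- {0})"
| inverted_linear: "\<xi> \<noteq> 0 \<Longrightarrow> model_weight (\<lambda>x. (x \<bullet> \<xi>) / (norm x)\<^sup>2) (- {0})"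
| arg_quadratic: "\<xi> \<noteq> 0 \<Longrightarrow> 0 \<le> \<theta> \<Longrightarrow> \<theta> < 2 * pi \<Longrightarrow>
     model_weight (\<lambda>x. arg (exp (\<i> * of_real \<theta>) * cdot (cvec x \<xi>) (cvec x \<xi>)))
       {x. exp (\<i> * of_real \<theta>) * cdot (cvec x \<xi>) (cvec x \<xi>) \<notin> \<real>\<^sub>\<le>\<^sub>0}"
| log_quotient: "\<xi> \<noteq> 0 \<Longrightarrow> model_weight (\<lambda>x. ln ((norm (x + \<xi>))\<^sup>2 / (norm (x - \<xi>))\<^sup>2)) (- {\<xi>, - \<xi>})"

end

(*
  Write V for the gradient of \<phi>, f = ln |V|, k = grad f. The weight condition says that the Hessian of
  \<phi> is determined by V and k: \<phi> has parallel gradient for the conformal metric exp (2 f) e. The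
  symmetry of third derivatives, used twice and in dimension at least 3, then forces
    D k = k (x) k + 2 c V (x) V - (|k|^2 / 2 + c |V|^2) I
  with a constant c. If s^2 = 2 c, with s real or imaginary, then q = exp (- f - s \<phi>) has Hessian a
  constant multiple of the identity, so that q is a quadratic polynomial; moreover its gradient has
  (bilinear) square proportional to q. For c > 0 the quotient of the two polynomials belonging to
  s and -s gives the logarithmic weights, and for c < 0 the argument of the complex polynomial q
  gives the weights of argument type. For c = 0, k is explicit and the linear weights and their
  inversions follow by integrating V.
*)

theory Submission
  imports Defs
begin

section \<open>Smooth functions and directional derivatives\<close>

definition dir_deriv :: "real^'n \<Rightarrow> (real^'n \<Rightarrow> real) \<Rightarrow> real^'n \<Rightarrow> real" where
  "dir_deriv a F x = frechet_derivative F (at x) a"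

lemma dir_deriv_eqI: "(F has_derivative F') (at x) \<Longrightarrow> dir_deriv a F x = F' a"
  unfolding dir_deriv_def by (metis frechet_derivative_at)

lemma dir_deriv_has_derivative: "F differentiable (at x) \<Longrightarrow> (F
    has_derivative (\<lambda>a. dir_deriv a F x)) (at x)"
  unfolding dir_deriv_def by (metis frechet_derivative_works)

section \<open>Closure properties of C^k and smooth functions on open sets\<close>

lemma Ck_on_Suc_dir_deriv:
  "Ck_on (Suc k) S f \<longleftrightarrow> f differentiable_on S \<and> (\<forall>j. Ck_on k S (dir_deriv (axis j 1) f))"
  unfolding Ck_on.simps dir_deriv_def[abs_def] ..

lemma has_derivative_cong_open:
  assumes "open S" "x \<in> S" "\<And>y. y \<in> S \<Longrightarrow> f y = g y"
  shows "(f has_derivative D) (at x) \<longleftrightarrow> (g has_derivative D) (at x)"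
  using assms has_derivative_transform_within_open[of f D x UNIV S g]
      has_derivative_transform_within_open[of g D x UNIV S f] by metis

lemma dir_deriv_cong:
  assumes "open S" "x \<in> S" "\<And>y. y \<in> S \<Longrightarrow> f y = g y"
  shows "dir_deriv a f x = dir_deriv a g x"
  using has_derivative_cong_open[OF assms]
  by (simp add: dir_deriv_def frechet_derivative_def)

text \<open>Rules for derivatives of sums, products and so on hold only at points of
  \<open>S\<close>. Openness lets them replace the total functions \<open>dir_deriv a f\<close>
  under the recursion of \<open>Ck_on\<close>.\<close>

lemma Ck_on_cong:
  assumes "open S" "\<And>y. y \<in> S \<Longrightarrow> f y = g y"
  shows "Ck_on k S f \<longleftrightarrow> Ck_on k S g"
  using assms(2)
proof (induction k arbitrary: f g)
  case 0
  then show ?case by (simp cong: continuous_on_cong)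
next
  case (Suc k)
  have "f differentiable_on S \<longleftrightarrow> g differentiable_on S"
    unfolding differentiable_on_eq_differentiable_at[OF assms(1)] differentiable_def
    using has_derivative_cong_open[OF assms(1) _ Suc.prems] by auto
  moreover have "Ck_on k S (dir_deriv (axis j 1) f) \<longleftrightarrow> Ck_on k S (dir_deriv (axis j 1) g)" for j
    by (intro Suc.IH dir_deriv_cong[OF assms(1)] Suc.prems)
  ultimately show ?case unfolding Ck_on_Suc_dir_deriv by blast
qed

lemma Ck_on_SucD: "Ck_on (Suc k) S f \<Longrightarrow> Ck_on k S f"
proof (induction k arbitrary: f)
  case 0
  then show ?case by (simp add: differentiable_imp_continuous_on)
next
  case (Suc k)
  then show ?case unfolding Ck_on_Suc_dir_deriv[of _ S f] by blast
qed

lemma Ck_on_subset: "Ck_on k S f \<Longrightarrow> T \<subseteq> S \<Longrightarrow> Ck_on k T f"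
  by (induction k arbitrary: f) (auto intro: continuous_on_subset differentiable_on_subset)

lemma Ck_on_const: "Ck_on k (S :: (real^'n) set) (\<lambda>_. c)"
proof (induction k arbitrary: c)
  case (Suc k)
  have "dir_deriv a (\<lambda>_. c) = (\<lambda>_. 0)" for a :: "real^'n"
    by (rule ext, rule dir_deriv_eqI) (rule has_derivative_const)
  then show ?case unfolding Ck_on_Suc_dir_deriv using Suc by simp
qed simp

context
  fixes S :: "(real^'n) set"
  assumes S: "open S"
begin

lemma Ck_on_Suc_has_derivative:
  assumes "Ck_on (Suc k) S f" "x \<in> S"
  shows "(f has_derivative (\<lambda>a. dir_deriv a f x)) (at x)"
  using assms S unfolding Ck_on_Suc_dir_deriv
  by (intro dir_deriv_has_derivative) (simp add: differentiable_on_eq_differentiable_at)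

lemma Ck_on_add: "Ck_on k S f \<Longrightarrow> Ck_on k S g \<Longrightarrow> Ck_on k S (\<lambda>x. f x + g x)"
proof (induction k arbitrary: f g)
  case 0
  then show ?case by (simp add: continuous_on_add)
next
  case (Suc k)
  have D: "((\<lambda>x. f x + g x) has_derivative (\<lambda>a. dir_deriv a f x + dir_deriv a g x)) (at x)"
    if "x \<in> S" for x
    using Suc.prems that by (intro has_derivative_add Ck_on_Suc_has_derivative)
  have "Ck_on k S (\<lambda>x. dir_deriv (axis j 1) f x + dir_deriv (axis j 1) g x)" for j
    using Suc.prems unfolding Ck_on_Suc_dir_deriv by (intro Suc.IH) auto
  then have "Ck_on k S (dir_deriv (axis j 1) (\<lambda>x. f x + g x))" for j
    by (subst Ck_on_cong[OF S dir_deriv_eqI[OF D]])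
  then show ?case
    using Suc.prems unfolding Ck_on_Suc_dir_deriv by (auto intro: differentiable_on_add)
qed

lemma Ck_on_mult: "Ck_on k S f \<Longrightarrow> Ck_on k S g \<Longrightarrow> Ck_on k S (\<lambda>x. f x * g x)"
proof (induction k arbitrary: f g)
  case 0
  then show ?case by (simp add: continuous_on_mult)
next
  case (Suc k)
  have D: "((\<lambda>x. f x * g x) has_derivative (\<lambda>a. f x * dir_deriv a g x + dir_deriv a f x * g x)) (at x)"
    if "x \<in> S" for x
    using Suc.prems that by (intro has_derivative_mult Ck_on_Suc_has_derivative)
  have "Ck_on k S (\<lambda>x. f x * dir_deriv (axis j 1) g x + dir_deriv (axis j 1) f x * g x)" for j
    using Suc.prems Ck_on_SucD[OF Suc.prems(1)] Ck_on_SucD[OF Suc.prems(2)]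
    unfolding Ck_on_Suc_dir_deriv by (intro Ck_on_add Suc.IH) auto
  then have "Ck_on k S (dir_deriv (axis j 1) (\<lambda>x. f x * g x))" for j
    by (subst Ck_on_cong[OF S dir_deriv_eqI[OF D]])
  then show ?case
    using Suc.prems unfolding Ck_on_Suc_dir_deriv by (auto intro: differentiable_on_mult)
qed

lemma Ck_on_sum: "(\<And>i. i \<in> I \<Longrightarrow> Ck_on k S (f i))
    \<Longrightarrow> Ck_on k S (\<lambda>x. \<Sum>i\<in>I. f i x)"
  by (induction I rule: infinite_finite_induct) (auto intro: Ck_on_const Ck_on_add)

text \<open>The induction closes because the derivative of 1/f is a product of f' with two copies of
  1/f, which is already known to be one order less regular.\<close>

lemma Ck_on_inverse:
  assumes "\<And>x. x \<in> S \<Longrightarrow> f x \<noteq> 0"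
  shows "Ck_on k S f \<Longrightarrow> Ck_on k S (\<lambda>x. inverse (f x))"
proof (induction k)
  case 0
  then show ?case using assms by (simp add: continuous_on_inverse)
next
  case (Suc k)
  have D: "((\<lambda>x. inverse (f x))
      has_derivative (\<lambda>a. - (inverse (f x) * dir_deriv a f x * inverse (f x)))) (at x)"
    if "x \<in> S" for x
    using Suc.prems that assms by (intro Deriv.has_derivative_inverse Ck_on_Suc_has_derivative)
  have "Ck_on k S (\<lambda>x. - 1 * (inverse (f x) * dir_deriv (axis j 1) f x * inverse (f x)))" for j
    using Suc.prems Ck_on_SucD[OF Suc.prems] unfolding Ck_on_Suc_dir_deriv
    by (intro Ck_on_mult Suc.IH Ck_on_const) auto
  then have "Ck_on k S (dir_deriv (axis j 1) (\<lambda>x. inverse (f x)))" for j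
    by (subst Ck_on_cong[OF S dir_deriv_eqI[OF D]]) auto
  moreover have "(\<lambda>x. inverse (f x)) differentiable_on S"
    using D S by (meson differentiable_on_eq_differentiable_at differentiable_def)
  ultimately show ?case unfolding Ck_on_Suc_dir_deriv by blast
qed

lemma Ck_on_ln:
  assumes "\<And>x. x \<in> S \<Longrightarrow> f x > 0"
  shows "Ck_on k S f \<Longrightarrow> Ck_on k S (\<lambda>x. ln (f x))"
proof (cases k)
  case 0
  assume "Ck_on k S f"
  with 0 show ?thesis using assms by (auto intro!: continuous_on_ln simp: less_imp_neq[symmetric])
next
  case (Suc m)
  assume f: "Ck_on k S f"
  have nz: "f x \<noteq> 0" if "x \<in> S" for x using assms[OF that] by simp
  have D: "((\<lambda>x. ln (f x)) has_derivative (\<lambda>a. dir_deriv a f x * inverse (f x))) (at x)"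
    if "x \<in> S" for x
    using f that assms unfolding Suc by (intro has_derivative_ln Ck_on_Suc_has_derivative)
  have "Ck_on m S (\<lambda>x. dir_deriv (axis j 1) f x * inverse (f x))" for j
    using f Ck_on_SucD[of m S f] nz unfolding Ck_on_Suc_dir_deriv Suc
    by (intro Ck_on_mult Ck_on_inverse) auto
  then have "Ck_on m S (dir_deriv (axis j 1) (\<lambda>x. ln (f x)))" for j
    by (subst Ck_on_cong[OF S dir_deriv_eqI[OF D]]) auto
  moreover have "(\<lambda>x. ln (f x)) differentiable_on S"
    using D S by (meson differentiable_on_eq_differentiable_at differentiable_def)
  ultimately show ?thesis unfolding Ck_on_Suc_dir_deriv Suc by blast
qed

lemma smooth_on_has_derivative:
  "smooth_on S f \<Longrightarrow> x \<in> S \<Longrightarrow> (f has_derivative (\<lambda>a. dir_deriv a f x)) (at x)"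
  by (rule Ck_on_Suc_has_derivative[of 0]) (simp_all only: smooth_on_def)

lemma smooth_on_linear_dir_deriv: "smooth_on S f \<Longrightarrow> x \<in> S
    \<Longrightarrow> linear (\<lambda>a. dir_deriv a f x)"
  by (rule has_derivative_linear) (rule smooth_on_has_derivative)

lemma dir_deriv_eq_sum_axis:
  assumes "smooth_on S f" "x \<in> S"
  shows "dir_deriv a f x = (\<Sum>j\<in>UNIV. a $ j * dir_deriv (axis j 1) f x)"
proof -
  interpret linear "\<lambda>a. dir_deriv a f x" using smooth_on_linear_dir_deriv[OF assms] .
  have "dir_deriv a f x = dir_deriv (\<Sum>j\<in>UNIV. a $ j *\<^sub>R axis j 1) f x"
    using basis_expansion[of a] by (simp add: scalar_mult_eq_scaleR)
  then show ?thesis by (simp add: sum scaleR)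
qed

lemma smooth_on_dir_deriv:
  assumes "smooth_on S f" shows "smooth_on S (dir_deriv a f)"
  unfolding smooth_on_def
proof
  fix k
  have "Ck_on (Suc k) S f" using assms by (simp only: smooth_on_def)
  then have "Ck_on k S (\<lambda>x. \<Sum>j\<in>UNIV. a $ j * dir_deriv (axis j 1) f x)"
    unfolding Ck_on_Suc_dir_deriv by (intro Ck_on_sum Ck_on_mult Ck_on_const) auto
  then show "Ck_on k S (dir_deriv a f)"
    by (subst Ck_on_cong[OF S dir_deriv_eq_sum_axis[OF assms]])
qed

lemma smooth_on_continuous_on: "smooth_on S f \<Longrightarrow> continuous_on S f"
  unfolding smooth_on_def by (metis Ck_on.simps(1))

lemma smooth_on_const: "smooth_on S (\<lambda>_. c)"
  by (simp add: smooth_on_def Ck_on_const)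

lemma smooth_on_add: "smooth_on S f \<Longrightarrow> smooth_on S g \<Longrightarrow> smooth_on S (\<lambda>x. f x + g x)"
  by (simp add: smooth_on_def Ck_on_add)

lemma smooth_on_mult: "smooth_on S f \<Longrightarrow> smooth_on S g \<Longrightarrow> smooth_on S (\<lambda>x. f x * g x)"
  by (simp add: smooth_on_def Ck_on_mult)

lemma smooth_on_sum:
  "(\<And>i. i \<in> I \<Longrightarrow> smooth_on S (f i)) \<Longrightarrow> smooth_on S (\<lambda>x. \<Sum>i\<in>I. f i x)"
  by (simp add: smooth_on_def Ck_on_sum)

lemma smooth_on_inverse:
  "smooth_on S f \<Longrightarrow> (\<And>x. x \<in> S \<Longrightarrow> f x \<noteq> 0)
      \<Longrightarrow> smooth_on S (\<lambda>x. inverse (f x))"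
  by (simp add: smooth_on_def Ck_on_inverse)

lemma smooth_on_ln:
  "smooth_on S f \<Longrightarrow> (\<And>x. x \<in> S \<Longrightarrow> f x > 0)
      \<Longrightarrow> smooth_on S (\<lambda>x. ln (f x))"
  by (simp add: smooth_on_def Ck_on_ln)

end

lemma smooth_on_subset: "smooth_on S f \<Longrightarrow> T \<subseteq> S \<Longrightarrow> smooth_on T f"
  unfolding smooth_on_def using Ck_on_subset by blast

section \<open>Symmetry of second derivatives\<close>

lemma second_difference_eq:
  fixes F :: "real^'n \<Rightarrow> real"
  assumes S: "open S" and F: "smooth_on S F" and B: "ball x \<delta> \<subseteq> S"
    and t: "t > 0" "t * (norm a + norm b) < \<delta>"
  shows "\<exists>y\<in>ball x \<delta>. F (x + t *\<^sub>R a + t *\<^sub>R b) - F (x + t *\<^sub>R a) - F (x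
      + t *\<^sub>R b) + F x
    = t * t * dir_deriv b (dir_deriv a F) y"
proof -
  have in_ball: "x + s *\<^sub>R a + r *\<^sub>R b \<in> ball x \<delta>"
      if "0 \<le> s" "s \<le> t" "0 \<le> r" "r \<le> t" for s r
  proof -
    have "norm (s *\<^sub>R a + r *\<^sub>R b) \<le> s * norm a + r * norm b"
      using norm_triangle_ineq[of "s *\<^sub>R a" "r *\<^sub>R b"] that by simp
    also have "\<dots> \<le> t * norm a + t * norm b"
      using that by (intro add_mono mult_right_mono) auto
    finally show ?thesis using t(2) by (simp add: dist_norm add.assoc algebra_simps norm_minus_commute)
  qed
  have D: "((\<lambda>r. G (y + r *\<^sub>R c)) has_real_derivative dir_deriv c G (y + r *\<^sub>R c)) (at r)"
    if "smooth_on S G" "y + r *\<^sub>R c \<in> S" for G y r c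
  proof -
    have lin: "linear (\<lambda>h. dir_deriv h G (y + r *\<^sub>R c))"
      using smooth_on_linear_dir_deriv[OF S that] .
    have "((\<lambda>r. y + r *\<^sub>R c) has_derivative (\<lambda>h. h *\<^sub>R c)) (at r)"
      by (auto intro!: derivative_eq_intros)
    from has_derivative_compose[OF this smooth_on_has_derivative[OF S that]]
    have "((\<lambda>r. G (y + r *\<^sub>R c)) has_derivative (\<lambda>h. dir_deriv (h *\<^sub>R c) G (y
        + r *\<^sub>R c))) (at r)" .
    also have "(\<lambda>h. dir_deriv (h *\<^sub>R c) G (y + r *\<^sub>R c)) = (*) (dir_deriv c G (y + r *\<^sub>R c))"
      using linear.scaleR[OF lin] by (auto simp: mult.commute)
    finally show ?thesis by (simp add: has_field_derivative_def)
  qed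
  \<comment> \<open>\<open>g\<close> is the increment of \<open>F\<close> in direction
    \<open>b\<close>, as a function of the displacement along \<open>a\<close>. The mean value
    theorem for \<open>g\<close> produces a derivative along \<open>a\<close>; a second application,
    along \<open>b\<close>, produces the mixed derivative.\<close>
  define g where "g s = F ((x + t *\<^sub>R b) + s *\<^sub>R a) - F (x + s *\<^sub>R a)" for s
  have "\<exists>s. 0 < s \<and> s < t \<and> g t - g 0 = (t - 0) * (dir_deriv a F ((x + t *\<^sub>R b)
      + s *\<^sub>R a) - dir_deriv a F (x + s *\<^sub>R a))"
    unfolding g_def using t
    by (intro MVT2 DERIV_diff D[OF F]) (use in_ball[of _ t] in_ball[of _ 0] B in \<open>auto simp: add_ac\<close>)
  then obtain s where s: "0 < s" "s < t"
    and gs: "g t - g 0 = t * (dir_deriv a F ((x + t *\<^sub>R b) + s *\<^sub>R a) - dir_deriv a F (x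
        + s *\<^sub>R a))" by auto
  have "\<exists>r. 0 < r \<and> r < t \<and> dir_deriv a F ((x + s *\<^sub>R a) + t *\<^sub>R b) - dir_deriv a F ((x
      + s *\<^sub>R a) + 0 *\<^sub>R b)
      = (t - 0) * dir_deriv b (dir_deriv a F) ((x + s *\<^sub>R a) + r *\<^sub>R b)"
    using t s by (intro MVT2 D[OF smooth_on_dir_deriv[OF S F]]) (use in_ball[of s] B in auto)
  then obtain r where r: "0 < r" "r < t"
    and gr: "dir_deriv a F ((x + t *\<^sub>R b) + s *\<^sub>R a) - dir_deriv a F (x + s *\<^sub>R a)
      = t * dir_deriv b (dir_deriv a F) (x + s *\<^sub>R a + r *\<^sub>R b)" by (auto simp: add_ac)
  have "g t - g 0 = t * t * dir_deriv b (dir_deriv a F) (x + s *\<^sub>R a + r *\<^sub>R b)"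
    using gs gr by simp
  moreover have "x + s *\<^sub>R a + r *\<^sub>R b \<in> ball x \<delta>"
    using s r by (intro in_ball) auto
  ultimately show ?thesis
    by (intro bexI[of _ "x + s *\<^sub>R a + r *\<^sub>R b"]) (auto simp: g_def add_ac)
qed

text \<open>The second difference is symmetric in \<open>a\<close> and \<open>b\<close>, so the two
  mixed derivatives agree at two points arbitrarily near \<open>x\<close>; their continuity carries
  this to \<open>x\<close>.\<close>

lemma dir_deriv_commute:
  fixes F :: "real^'n \<Rightarrow> real"
  assumes S: "open S" and F: "smooth_on S F" and x: "x \<in> S"
  shows "dir_deriv a (dir_deriv b F) x = dir_deriv b (dir_deriv a F) x"
proof (rule ccontr)
  define P Q where "P = dir_deriv a (dir_deriv b F)" and "Q = dir_deriv b (dir_deriv a F)"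
  assume "dir_deriv a (dir_deriv b F) x \<noteq> dir_deriv b (dir_deriv a F) x"
  then have PQ: "P x \<noteq> Q x" by (simp add: P_def Q_def)
  define \<epsilon> where "\<epsilon> = \<bar>P x - Q x\<bar> / 2"
  have \<epsilon>: "\<epsilon> > 0" using PQ by (simp add: \<epsilon>_def)
  have "continuous (at x) P" "continuous (at x) Q"
    using smooth_on_continuous_on[OF S smooth_on_dir_deriv[OF S smooth_on_dir_deriv[OF S F]]]
    by (simp_all add: P_def Q_def continuous_on_eq_continuous_at[OF S] x)
  then obtain d1 d2 where d1: "d1 > 0" "\<And>y. dist y x < d1 \<Longrightarrow> dist (P y) (P x) < \<epsilon>"
    and d2: "d2 > 0" "\<And>y. dist y x < d2 \<Longrightarrow> dist (Q y) (Q x) < \<epsilon>"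
    using \<epsilon> unfolding continuous_at_eps_delta by metis
  obtain d3 where d3: "d3 > 0" "ball x d3 \<subseteq> S" using S x openE by blast
  define \<delta> where "\<delta> = min d1 (min d2 d3)"
  have \<delta>: "\<delta> > 0" "ball x \<delta> \<subseteq> S" using d1 d2 d3 by (auto simp: \<delta>_def)
  \<comment> \<open>With this \<open>t\<close> the whole parallelogram stays within \<delta>/2 of
    \<open>x\<close>; the summand 1 keeps the denominator positive even for
    \<open>a = b = 0\<close>.\<close>
  define t where "t = \<delta> / (2 * (norm a + norm b + 1))"
  have pos: "norm a + norm b + 1 > 0" by (simp add: add_nonneg_pos)
  have t: "t > 0" using \<delta> pos by (simp add: t_def)
  have "t * (norm a + norm b) \<le> t * (norm a + norm b + 1)" using t by simp
  also have "\<dots> = \<delta> / 2" using pos by (simp add: t_def field_simps)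
  also have "\<dots> < \<delta>" using \<delta> by simp
  finally have tb: "t * (norm a + norm b) < \<delta>" .
  obtain y where y: "y \<in> ball x \<delta>"
    "F (x + t *\<^sub>R a + t *\<^sub>R b) - F (x + t *\<^sub>R a) - F (x + t *\<^sub>R b) + F x = t * t * Q y"
    using second_difference_eq[OF S F \<delta>(2) t tb] unfolding Q_def by blast
  obtain z where z: "z \<in> ball x \<delta>"
    "F (x + t *\<^sub>R b + t *\<^sub>R a) - F (x + t *\<^sub>R b) - F (x + t *\<^sub>R a) + F x = t * t * P z"
    using second_difference_eq[OF S F \<delta>(2) t, of b a] tb unfolding P_def by (auto simp: add_ac)
  have swap: "x + t *\<^sub>R a + t *\<^sub>R b = x + t *\<^sub>R b + t *\<^sub>R a" by (simp add: add_ac)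
  have "t * t * P z = t * t * Q y"
    unfolding y(2)[symmetric] z(2)[symmetric] swap by (simp add: algebra_simps)
  then have "P z = Q y" using t by simp
  moreover have "dist (P z) (P x) < \<epsilon>" "dist (Q y) (Q x) < \<epsilon>"
    using y(1) z(1) d1(2)[of z] d2(2)[of y] by (simp_all add: \<delta>_def dist_commute)
  ultimately show False unfolding \<epsilon>_def dist_real_def by argo
qed

section \<open>The Poisson bracket\<close>

lemma diff_covec_inner:
  assumes "open S" "smooth_on S f" "x \<in> S"
  shows "diff_covec f x \<bullet> a = dir_deriv a f x"
  unfolding dir_deriv_eq_sum_axis[OF assms, of a]
  by (simp add: diff_covec_def inner_vec_def dir_deriv_def mult.commute)

lemma smooth_on_diff_covec_nth:
  "open S \<Longrightarrow> smooth_on S f \<Longrightarrow> smooth_on S (\<lambda>x. diff_covec f x $ j)"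
  using smooth_on_dir_deriv[of S f "axis j 1"] by (simp add: diff_covec_def dir_deriv_def[abs_def])

text \<open>The components of the left side are derivatives along \<open>h\<close> of axis
  derivatives; commuting them turns the derivative of the gradient into the gradient of
  \<open>dir_deriv h f\<close>.\<close>

lemma diff_covec_has_derivative:
  assumes "open S" "smooth_on S f" "x \<in> S"
  shows "(diff_covec f has_derivative (\<lambda>h. diff_covec (dir_deriv h f) x)) (at x)"
proof -
  have "((\<lambda>y. diff_covec f y $ j) has_derivative (\<lambda>h. diff_covec (dir_deriv h f) x $ j)) (at x)" for j
  proof -
    have "(dir_deriv (axis j 1) f has_derivative (\<lambda>h. dir_deriv h (dir_deriv (axis j 1) f) x)) (at x)"
      using assms by (intro smooth_on_has_derivative smooth_on_dir_deriv)
    then show ?thesis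
      using dir_deriv_commute[OF assms] by (simp add: diff_covec_def dir_deriv_def[abs_def])
  qed
  then show ?thesis
    by (subst has_derivative_componentwise_within) (auto simp: Basis_vec_def inner_axis)
qed

lemma dir_deriv_inner:
  assumes "(V has_derivative V') (at x)" "(W has_derivative W') (at x)"
  shows "dir_deriv a (\<lambda>y. V y \<bullet> W y) x = V x \<bullet> W' a + V' a \<bullet> W x"
  by (rule dir_deriv_eqI) (rule has_derivative_inner[OF assms])

text \<open>Writing the symbol as a + 2 i b with a, b real, antisymmetry gives {a - 2 i b, a + 2 i
  b} = 4 i {a, b}, and {a, b} is twice the sum of the Hessian of \<open>f\<close> at (\<xi>, \<xi>)
  and at (V, V).\<close>

lemma poisson_bracket_symbol:
  assumes S: "open S" "smooth_on S f" "x \<in> S"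
  defines "V \<equiv> diff_covec f x"
  shows "poisson_bracket (\<lambda>z. cnj (symbol f z)) (symbol f) (x, \<xi>)
    = 8 * \<i> * of_real (dir_deriv \<xi> (dir_deriv \<xi> f) x + dir_deriv V (dir_deriv V f) x)"
proof -
  define DV where "DV h = diff_covec (dir_deriv h f) x" for h
  \<comment> \<open>\<open>A\<close> is the differential at \<open>(x, \<xi>)\<close> of the real
    part of the symbol and \<open>B\<close> that of half its imaginary part; \<open>DV\<close> is
    the Hessian as an endomorphism.\<close>
  define A where "A = (\<lambda>(h, \<eta>). 2 * (\<xi> \<bullet> \<eta>) - 2 * (V \<bullet> DV h))"
  define B where "B = (\<lambda>(h, \<eta>). \<xi> \<bullet> DV h + \<eta> \<bullet> V)"
  have "((\<lambda>z. diff_covec f (fst z)) has_derivative (\<lambda>p. DV (fst p))) (at (x, \<xi>))"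
    using diff_covec_has_derivative[OF S] unfolding DV_def
    by (intro has_derivative_compose[OF has_derivative_fst[OF has_derivative_ident]]) simp
  note dV = this
  have "(symbol f has_derivative
      (\<lambda>p. of_real (A p) + 2 * \<i> * of_real (B p))) (at (x, \<xi>))"
    unfolding symbol_def power2_norm_eq_inner case_prod_beta A_def B_def
    by (rule derivative_eq_intros dV refl | simp add: V_def inner_commute)+
  note D = this
  have Dc: "((\<lambda>z. cnj (symbol f z)) has_derivative
      (\<lambda>p. of_real (A p) - 2 * \<i> * of_real (B p))) (at (x, \<xi>))"
    using has_derivative_cnj[OF D] by simp
  have lin: "linear DV"
    using has_derivative_linear[OF diff_covec_has_derivative[OF S]] unfolding DV_def .
  have sum_axis: "(\<Sum>j\<in>UNIV. v $ j *\<^sub>R DV (axis j 1)) = DV v" for v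
    using basis_expansion[of v] linear_sum[OF lin, of "\<lambda>j. v $ j *s axis j 1" UNIV]
    by (simp add: linear.scaleR[OF lin] scalar_mult_eq_scaleR)
  have AV: "DV a \<bullet> b = dir_deriv b (dir_deriv a f) x" for a b
    unfolding DV_def by (rule diff_covec_inner) (use S smooth_on_dir_deriv in blast)+
  have "poisson_bracket (\<lambda>z. cnj (symbol f z)) (symbol f) (x, \<xi>) =
     (\<Sum>j\<in>UNIV. 4 * \<i> * of_real (A (0, axis j 1) * B (axis j 1, 0) - B (0, axis j 1) * A (axis j 1, 0)))"
    unfolding poisson_bracket_def frechet_derivative_at[OF D, symmetric]
      frechet_derivative_at[OF Dc, symmetric]
    by (intro sum.cong refl) (simp add: algebra_simps)
  also have "\<dots> = 4 * \<i> * of_real (\<Sum>j\<in>UNIV. A (0, axis j 1) * B (axis j 1, 0) - B (0, axis j 1) * A (axis j 1, 0))"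
    by (simp add: sum_distrib_left)
  also have "(\<Sum>j\<in>UNIV. A (0, axis j 1) * B (axis j 1, 0) - B (0, axis j 1) * A (axis j 1, 0))
      = (\<Sum>j\<in>UNIV. 2 * (\<xi> \<bullet> (\<xi> $ j *\<^sub>R DV (axis j 1)))
          + 2 * (V \<bullet> (V $ j *\<^sub>R DV (axis j 1))))"
    using linear_0[OF lin]
    by (intro sum.cong refl) (simp add: A_def B_def inner_axis inner_axis' algebra_simps)
  also have "\<dots> = 2 * (\<xi> \<bullet> DV \<xi>) + 2 * (V \<bullet> DV V)"
    unfolding sum.distrib sum_distrib_left[symmetric] inner_sum_right[symmetric] sum_axis ..
  finally show ?thesis by (simp add: AV inner_commute[of _ "DV _"])
qed

text \<open>The two conditions on \<xi> are the real and the imaginary part of the equation that the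
  symbol vanishes.\<close>

lemma limiting_carleman_weight_Hessian:
  assumes S: "open S" and \<phi>: "limiting_carleman_weight S \<phi>" and x: "x \<in> S"
  defines "V \<equiv> diff_covec \<phi> x"
  assumes "norm \<xi> = norm V" "\<xi> \<bullet> V = 0"
  shows "dir_deriv \<xi> (dir_deriv \<xi> \<phi>) x + dir_deriv V (dir_deriv V \<phi>) x = 0"
proof -
  have "symbol \<phi> (x, \<xi>) = 0" using assms by (simp add: symbol_def)
  then have "poisson_bracket (\<lambda>z. cnj (symbol \<phi> z)) (symbol \<phi>) (x, \<xi>) = 0"
    using \<phi> x unfolding limiting_carleman_weight_def by blast
  moreover have "smooth_on S \<phi>" using \<phi> by (simp add: limiting_carleman_weight_def)
  ultimately show ?thesis
    unfolding poisson_bracket_symbol[OF S \<open>smooth_on S \<phi>\<close> x] V_def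
    by (metis mult_eq_0_iff of_real_eq_0_iff complex_i_not_zero zero_neq_numeral)
qed

section \<open>The differential system of a limiting Carleman weight\<close>

lemma exists_orthogonal_pair:
  fixes u v :: "'a::euclidean_space"
  assumes "DIM('a) \<ge> 3"
  shows "\<exists>a. a \<noteq> 0 \<and> a \<bullet> u = 0 \<and> a \<bullet> v = 0"
proof -
  have "dim {u, v} \<le> card {u, v}" by (intro dim_le_card') auto
  also have "\<dots> \<le> 2" by (simp add: card_insert_if)
  finally have "dim {u, v} < DIM('a)" using assms by linarith
  then obtain a where a: "a \<noteq> 0" "\<And>y. y \<in> span {u, v} \<Longrightarrow> orthogonal a y"
    using orthogonal_to_subspace_exists by blast
  then have "orthogonal a u" "orthogonal a v"
    by (simp_all add: span_base)
  then show ?thesis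
    using a(1) by (auto simp: orthogonal_def)
qed

text \<open>By scaling, \<open>tr\<close> fixes the quadratic form of \<open>H\<close> on the
  complement of \<open>V\<close> as a multiple of the norm squared; polarisation gives
  \<open>H\<close> there, and \<open>k\<close> supplies all entries involving
  \<open>V\<close>.\<close>

lemma bilinear_eq_of_orthogonal_trace:
  fixes H :: "'a::real_inner \<Rightarrow> 'a \<Rightarrow> real"
  assumes H: "bilinear H" and sym: "\<And>a b. H a b = H b a" and V: "V \<noteq> 0"
    and tr: "\<And>\<xi>. \<xi> \<bullet> V = 0 \<Longrightarrow> norm \<xi> = norm V \<Longrightarrow> H \<xi> \<xi>
        + H V V = 0"
    and k: "\<And>a. H a V = (V \<bullet> V) * (k \<bullet> a)"
  shows "H a b = (V \<bullet> a) * (k \<bullet> b) + (k \<bullet> a) * (V \<bullet> b) - (V \<bullet> k) * (a \<bullet> b)"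
proof -
  define e w where "e = V \<bullet> V" and "w = V \<bullet> k"
  have e: "e > 0" using V by (simp add: e_def)
  note bil = bilinear_ladd[OF H] bilinear_radd[OF H] bilinear_lmul[OF H] bilinear_rmul[OF H]
    bilinear_lsub[OF H] bilinear_rsub[OF H] bilinear_lzero[OF H] bilinear_rzero[OF H]
  have VV: "H V V = e * w" by (simp add: k e_def w_def inner_commute)
  have diag: "H a a = - w * (a \<bullet> a)" if "a \<bullet> V = 0" for a
  proof (cases "a = 0")
    case False
    define t where "t = norm V / norm a"
    have t: "t * t * (a \<bullet> a) = e"
      using False by (simp add: t_def e_def power2_norm_eq_inner[symmetric] power2_eq_square)
    have "H (t *\<^sub>R a) (t *\<^sub>R a) + H V V = 0"
      using False that by (intro tr) (auto simp: t_def)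
    then have "t * t * H a a + e * w = 0" by (simp add: bil VV)
    then have "(t * t) * (H a a - - w * (a \<bullet> a)) = 0" using t by (simp add: algebra_simps)
    moreover have "t * t \<noteq> 0" using t e by auto
    ultimately show ?thesis by (metis mult_eq_0_iff right_minus_eq)
  qed (simp add: bil)
  have perp: "H a b = - w * (a \<bullet> b)" if "a \<bullet> V = 0" "b \<bullet> V = 0" for a b
  proof -
    have "H (a + b) (a + b) = - w * ((a + b) \<bullet> (a + b))"
      using that by (intro diag) (simp add: inner_add_left)
    then show ?thesis
      using diag[OF that(1)] diag[OF that(2)] sym[of b a]
      by (simp add: bil inner_add_left inner_add_right inner_commute algebra_simps)
  qed
  \<comment> \<open>\<open>\<alpha> *\<^sub>R V\<close> and \<open>\<beta> *\<^sub>R V\<close> are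
    the orthogonal projections of \<open>a\<close> and \<open>b\<close> to the line of
    \<open>V\<close>.\<close>
  define \<alpha> \<beta> where "\<alpha> = (V \<bullet> a) / e" and "\<beta> = (V \<bullet> b) / e"
  have \<alpha>: "V \<bullet> a = \<alpha> * e" and \<beta>: "V \<bullet> b = \<beta> * e" using e
      by (simp_all add: \<alpha>_def \<beta>_def)
  have "H (a - \<alpha> *\<^sub>R V) (b - \<beta> *\<^sub>R V)
      = - w * ((a - \<alpha> *\<^sub>R V) \<bullet> (b - \<beta> *\<^sub>R V))"
    using \<alpha> \<beta> by (intro perp) (simp_all add: inner_diff_left inner_commute[of a V] inner_commute[of b V] e_def)
  moreover have "H (a - \<alpha> *\<^sub>R V) (b - \<beta> *\<^sub>R V) = H a b - \<beta> * H a V - \<alpha> * H V b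
      + \<alpha> * \<beta> * H V V"
    unfolding bil real_scaleR_def by argo
  moreover have "(a - \<alpha> *\<^sub>R V) \<bullet> (b - \<beta> *\<^sub>R V)
      = a \<bullet> b - \<beta> * (V \<bullet> a) - \<alpha> * (V \<bullet> b) + \<alpha> * \<beta> * (V \<bullet> V)"
    unfolding inner_diff_left inner_diff_right inner_scaleR_left inner_scaleR_right inner_commute[of a V] by argo
  ultimately have "H a b - \<beta> * (e * (k \<bullet> a)) - \<alpha> * (e * (k \<bullet> b))
      + \<alpha> * \<beta> * (e * w) =
      - w * (a \<bullet> b - \<beta> * (\<alpha> * e) - \<alpha> * (\<beta> * e) + \<alpha> * \<beta> * e)"
    unfolding VV k[of a] sym[of V b] k[of b] \<alpha> \<beta> e_def[symmetric] by (simp only:)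
  then show ?thesis
    unfolding \<alpha> \<beta> w_def[symmetric] by (simp add: algebra_simps)
qed

text \<open>\<open>C\<close> has the shape of the condition obtained by exchanging third derivatives
  of \<phi>. Taking for both \<open>a\<close> and \<open>b\<close> one vector orthogonal to
  \<open>V\<close> and \<open>c\<close> shows that \<open>g\<close> vanishes on the complement of
  \<open>V\<close>; this is where dimension 3 enters. Inserting \<open>V\<close> into the slots of
  \<open>C\<close> then gives first \<open>A c V\<close> and finally all of \<open>A\<close>. The
  numbers \<rho> and \<beta> are read off along \<open>V\<close>.\<close>

lemma symmetric_bilinear_of_Codazzi:
  fixes A :: "'a::euclidean_space \<Rightarrow> 'a \<Rightarrow> real"
  assumes dim: "DIM('a) \<ge> 3" and V: "V \<noteq> 0" and sym: "\<And>a b. A a b = A b a"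
    and C: "\<And>a b c. A a c * (V \<bullet> b) - A a b * (V \<bullet> c)
        = (g \<bullet> c) * (a \<bullet> b) - (g \<bullet> b) * (a \<bullet> c)"
    and \<rho>: "g \<bullet> V = - \<rho> * (V \<bullet> V)"
    and \<beta>: "A V V = \<rho> * (V \<bullet> V) + \<beta> * (V \<bullet> V)\<^sup>2"
  shows "A a b = \<rho> * (a \<bullet> b) + \<beta> * (V \<bullet> a) * (V \<bullet> b)"
proof -
  define e where "e = V \<bullet> V"
  have e: "e > 0" using V by (simp add: e_def)
  have g0: "g \<bullet> c = 0" if "V \<bullet> c = 0" for c
  proof -
    obtain b where b: "b \<noteq> 0" "b \<bullet> V = 0" "b \<bullet> c = 0" using exists_orthogonal_pair[OF dim] by blast
    then have "(g \<bullet> c) * (b \<bullet> b) = 0" using C[of b c b] that by (simp add: inner_commute)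
    with b show ?thesis by simp
  qed
  have g: "g \<bullet> c = - \<rho> * (V \<bullet> c)" for c
  proof -
    have "g \<bullet> (c - ((V \<bullet> c) / e) *\<^sub>R V) = 0"
      using e by (intro g0) (simp add: inner_diff_right e_def)
    then show ?thesis using e by (simp add: inner_diff_right \<rho> e_def[symmetric] algebra_simps eq_neg_iff_add_eq_0)
  qed
  have AV: "A c V = (\<rho> + \<beta> * e) * (V \<bullet> c)" for c
  proof -
    have "e * A c V = e * ((\<rho> + \<beta> * e) * (V \<bullet> c))"
      using C[of V c V] by (simp add: g \<beta> e_def[symmetric] sym[of V c] algebra_simps power2_eq_square)
    then show ?thesis using e by simp
  qed
  have "e * A a b = e * (\<rho> * (a \<bullet> b) + \<beta> * (V \<bullet> a) * (V \<bullet> b))"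
    using C[of a b V] by (simp add: g AV e_def[symmetric] inner_commute[of a V] algebra_simps)
  then show ?thesis using e by simp
qed

text \<open>This is the second exchange of derivatives, with \<open>B\<close> the differential of
  the unknown function \<beta>. A vector \<open>a\<close> orthogonal to \<open>V\<close> and
  \<open>c\<close> isolates \<open>r c\<close>; after that, \<open>a = V\<close> compares
  \<open>B c\<close> with \<open>B V\<close>.\<close>

lemma gradient_parallel_of_Codazzi:
  fixes V :: "'a::euclidean_space" and B r :: "'a \<Rightarrow> real"
  assumes dim: "DIM('a) \<ge> 3" and V: "V \<noteq> 0"
    and C: "\<And>a b c. 2 * (V \<bullet> a) * (B c * (V \<bullet> b) - B b * (V \<bullet> c))
        + (a \<bullet> b) * r c - (a \<bullet> c) * r b = 0"
  shows "r c = 0" "B c * (V \<bullet> V) = B V * (V \<bullet> c)"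
proof -
  show r: "r c = 0" for c
  proof -
    obtain a where "a \<noteq> 0" "a \<bullet> V = 0" "a \<bullet> c = 0" using exists_orthogonal_pair[OF dim] by blast
    then show ?thesis using C[of a c a] by (simp add: inner_commute)
  qed
  show "B c * (V \<bullet> V) = B V * (V \<bullet> c)"
    using C[of V c V] V by (simp add: r)
qed

section \<open>Product rules for directional derivatives on an open set\<close>

context
  fixes S :: "(real^'n) set"
  assumes S: "open S"
begin

lemma dir_deriv_mult:
  "smooth_on S f \<Longrightarrow> smooth_on S g \<Longrightarrow> x \<in> S \<Longrightarrow>
    dir_deriv a (\<lambda>x. f x * g x) x = f x * dir_deriv a g x + dir_deriv a f x * g x"
  by (rule dir_deriv_eqI) (intro has_derivative_mult smooth_on_has_derivative[OF S])

lemma dir_deriv_cmult: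
  "smooth_on S f \<Longrightarrow> x \<in> S \<Longrightarrow> dir_deriv a (\<lambda>x. c * f x) x = c * dir_deriv a f x"
  using dir_deriv_mult[OF smooth_on_const[OF S], of f x a c] dir_deriv_eqI[of "\<lambda>_. c" "\<lambda>_. 0" x a] by simp

lemma dir_deriv_add:
  "smooth_on S f \<Longrightarrow> smooth_on S g \<Longrightarrow> x \<in> S \<Longrightarrow>
    dir_deriv a (\<lambda>x. f x + g x) x = dir_deriv a f x + dir_deriv a g x"
  by (rule dir_deriv_eqI) (intro has_derivative_add smooth_on_has_derivative[OF S])

lemma smooth_on_diff:
  "smooth_on S f \<Longrightarrow> smooth_on S g \<Longrightarrow> smooth_on S (\<lambda>x. f x - g x)"
  using smooth_on_add[OF S, of f "\<lambda>x. - 1 * g x"] smooth_on_mult[OF S smooth_on_const[OF S, of "-1"], of g]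
  by simp

lemma dir_deriv_mult_add_mult_diff:
  assumes "smooth_on S p" "smooth_on S q" "smooth_on S r" "smooth_on S t" "smooth_on S u" "x \<in> S"
  shows "dir_deriv a (\<lambda>x. p x * q x + r x * t x - s * u x) x =
    p x * dir_deriv a q x + dir_deriv a p x * q x + (r x * dir_deriv a t x + dir_deriv a r x * t x) - s * dir_deriv a u x"
  by (rule dir_deriv_eqI) (intro has_derivative_add has_derivative_diff has_derivative_mult
      has_derivative_mult_right smooth_on_has_derivative[OF S] assms)

lemma smooth_on_inner_diff_covec:
  "smooth_on S f \<Longrightarrow> smooth_on S g
      \<Longrightarrow> smooth_on S (\<lambda>x. diff_covec f x \<bullet> diff_covec g x)"
  unfolding inner_vec_def inner_real_def
  by (intro smooth_on_sum[OF S] smooth_on_mult[OF S] smooth_on_diff_covec_nth[OF S])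

lemma dir_deriv_inner_diff_covec:
  assumes "smooth_on S f" "smooth_on S g" "x \<in> S"
  shows "dir_deriv a (\<lambda>x. diff_covec f x \<bullet> diff_covec g x) x =
    dir_deriv a (dir_deriv (diff_covec f x) g) x + dir_deriv a (dir_deriv (diff_covec g x) f) x"
proof -
  have *: "diff_covec (dir_deriv a h) x \<bullet> v = dir_deriv a (dir_deriv v h) x" if h: "smooth_on S h" for h v
    by (rule trans[OF diff_covec_inner[OF S smooth_on_dir_deriv[OF S h] assms(3)] dir_deriv_commute[OF S h assms(3)]])
  show ?thesis
    unfolding dir_deriv_inner[OF diff_covec_has_derivative[OF S assms(1,3)] diff_covec_has_derivative[OF S assms(2,3)]]
      *[OF assms(1)] inner_commute[of _ "diff_covec (dir_deriv a g) x"] *[OF assms(2)] ..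
qed

lemma bilinear_dir_deriv_dir_deriv:
  assumes "smooth_on S f" "x \<in> S"
  shows "bilinear (\<lambda>a b. dir_deriv b (dir_deriv a f) x)"
proof -
  have "linear (\<lambda>b. dir_deriv b (dir_deriv a f) x)" for a
    by (rule smooth_on_linear_dir_deriv[OF S smooth_on_dir_deriv[OF S assms(1)] assms(2)])
  moreover from this have "linear (\<lambda>a. dir_deriv b (dir_deriv a f) x)" for b
    using dir_deriv_commute[OF S assms, of b] by (simp only:)
  ultimately show ?thesis unfolding bilinear_def by blast
qed

end

text \<open>The system says that \<open>\<phi>\<close> has parallel gradient
    for the metric \<open>exp (2 * f) * e\<close> and that the
  Schouten tensor of this metric is determined by \<open>\<phi>\<close>
      and a constant \<open>c\<close>; it is of finite type.\<close>

definition carleman_system ::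
  "(real^'n) set \<Rightarrow> real \<Rightarrow> (real^'n \<Rightarrow> real) \<Rightarrow> (real^'n \<Rightarrow> real^'n) \<Rightarrow> (real^'n \<Rightarrow> real) \<Rightarrow> (real^'n \<Rightarrow> real^'n) \<Rightarrow> bool" where
  "carleman_system S c \<phi> V f k \<longleftrightarrow> (\<forall>x\<in>S. V x \<noteq> 0 \<and>
     (\<phi> has_derivative (\<lambda>h. V x \<bullet> h)) (at x) \<and>
     (f has_derivative (\<lambda>h. k x \<bullet> h)) (at x) \<and>
     (V has_derivative (\<lambda>h. (k x \<bullet> h) *\<^sub>R V x
         + (V x \<bullet> h) *\<^sub>R k x - (V x \<bullet> k x) *\<^sub>R h)) (at x) \<and>
     (k has_derivative (\<lambda>h. (k x \<bullet> h) *\<^sub>R k x + (2 * c * (V x \<bullet> h)) *\<^sub>R V x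
        - (k x \<bullet> k x / 2 + c * (V x \<bullet> V x)) *\<^sub>R h)) (at x))"

text \<open>Exchanging third derivatives of \<phi> determines the Hessian of \<open>f\<close> up to
  one function \<beta>; exchanging those of \<open>f\<close> makes the differential of \<beta>
  vanish, and convexity yields the constant \<open>c\<close>.\<close>

lemma limiting_carleman_weight_system:
  fixes \<phi> :: "real^'n \<Rightarrow> real"
  assumes dim: "CARD('n) \<ge> 3" and S: "open S" "convex S" and \<phi>: "limiting_carleman_weight S \<phi>"
  shows "\<exists>c f k. carleman_system S c \<phi> (diff_covec \<phi>) f k"
proof -
  have sp: "smooth_on S \<phi>" and Vnz: "\<And>x. x \<in> S \<Longrightarrow> diff_covec \<phi> x \<noteq> 0"
    using \<phi> by (auto simp: limiting_carleman_weight_def)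
  have dim': "DIM(real^'n) \<ge> 3" using dim by simp
  define V where "V = diff_covec \<phi>"
  define e where "e x = V x \<bullet> V x" for x
  \<comment> \<open>This is ln |V|, written through the squared norm to avoid differentiating a
    square root.\<close>
  define f where "f x = 1 / 2 * ln (e x)" for x
  define k where "k = diff_covec f"
  define w where "w x = V x \<bullet> k x" for x
  define \<kappa> where "\<kappa> x = k x \<bullet> k x" for x
  \<comment> \<open>This solves for the single unknown along \<open>V\<close>: both the value of D k
    - k (x) k at (V, V) and the product of \<open>V\<close> with \<open>grad w - w k\<close> lead to
    \<open>\<beta> * e * e = dir_deriv V w - w * w - \<kappa> * e / 2\<close>, with \<theta> as
    defined next.\<close>
  define \<beta> where "\<beta> x
      = ((V x \<bullet> diff_covec w x - w x * w x) * inverse (e x) - 1 / 2 * \<kappa> x) * inverse (e x)" for x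
  define \<theta> where "\<theta> x = 1 / 2 * \<kappa> x + \<beta> x * e x" for x
  have epos: "e x > 0" if "x \<in> S" for x using Vnz[OF that] by (simp add: e_def V_def)
  have enz: "e x \<noteq> 0" if "x \<in> S" for x using epos[OF that] by simp
  have se: "smooth_on S e"
    unfolding e_def[abs_def] V_def by (intro smooth_on_inner_diff_covec S sp)
  have sle: "smooth_on S (\<lambda>x. ln (e x))" by (intro smooth_on_ln S se epos)
  have sf: "smooth_on S f"
    unfolding f_def[abs_def] by (intro smooth_on_mult smooth_on_const S sle)
  have sw: "smooth_on S w"
    unfolding w_def[abs_def] V_def k_def by (intro smooth_on_inner_diff_covec S sp sf)
  have s\<kappa>: "smooth_on S \<kappa>"
    unfolding \<kappa>_def[abs_def] k_def by (intro smooth_on_inner_diff_covec S sf)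
  have s\<beta>: "smooth_on S \<beta>"
    unfolding \<beta>_def[abs_def] V_def
    by (intro smooth_on_mult smooth_on_diff smooth_on_inverse smooth_on_const
        smooth_on_inner_diff_covec S sp sw se s\<kappa> enz)
  have s\<theta>: "smooth_on S \<theta>"
    unfolding \<theta>_def[abs_def] by (intro smooth_on_mult smooth_on_add smooth_on_const S s\<kappa> s\<beta> se)
  note sm = sp sf sw se s\<kappa> s\<beta> s\<theta> S(1) smooth_on_dir_deriv smooth_on_mult smooth_on_diff smooth_on_add smooth_on_const
  have V: "V x \<bullet> a = dir_deriv a \<phi> x" and k: "k x \<bullet> a = dir_deriv a f x" if "x \<in> S" for x a
    unfolding V_def k_def
    by (rule diff_covec_inner[OF S(1) sp that], rule diff_covec_inner[OF S(1) sf that])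
  have HV: "dir_deriv (V x) (dir_deriv a \<phi>) x = e x * (k x \<bullet> a)" if x: "x \<in> S" for x a
  proof -
    have "((\<lambda>x. ln (e x)) has_derivative (\<lambda>a. dir_deriv a e x * inverse (e x))) (at x)"
      using smooth_on_has_derivative[OF S(1) se x] epos[OF x] by (rule has_derivative_ln[rotated])
    from dir_deriv_eqI[OF this] have "dir_deriv a f x = 1 / 2 * (dir_deriv a e x * inverse (e x))"
      unfolding f_def[abs_def] dir_deriv_cmult[OF S(1) sle x] by simp
    moreover have "dir_deriv a e x = 2 * dir_deriv a (dir_deriv (V x) \<phi>) x"
      unfolding e_def[abs_def] V_def dir_deriv_inner_diff_covec[OF S(1) sp sp x] by simp
    ultimately show ?thesis
      using enz[OF x] dir_deriv_commute[OF S(1) sp x] by (simp add: k[OF x] field_simps)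
  qed
  have Hess: "dir_deriv b (dir_deriv a \<phi>) x = dir_deriv a \<phi> x * dir_deriv b f x
      + dir_deriv a f x * dir_deriv b \<phi> x - w x * (a \<bullet> b)"
    if x: "x \<in> S" for x a b
  proof -
    have "dir_deriv b (dir_deriv a \<phi>) x = (V x \<bullet> a) * (k x \<bullet> b)
        + (k x \<bullet> a) * (V x \<bullet> b) - (V x \<bullet> k x) * (a \<bullet> b)"
    proof (rule bilinear_eq_of_orthogonal_trace[of "\<lambda>a b. dir_deriv b (dir_deriv a \<phi>) x"])
      show "bilinear (\<lambda>a b. dir_deriv b (dir_deriv a \<phi>) x)" by (rule bilinear_dir_deriv_dir_deriv[OF S(1) sp x])
      show "V x \<noteq> 0" using Vnz[OF x] by (simp add: V_def)
      show "dir_deriv a (dir_deriv b \<phi>) x = dir_deriv b (dir_deriv a \<phi>) x" for a b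
          by (rule dir_deriv_commute[OF S(1) sp x])
      show "dir_deriv (V x) (dir_deriv a \<phi>) x = V x \<bullet> V x * (k x \<bullet> a)" for a using HV[OF x]
          by (simp add: e_def)
      show "dir_deriv \<xi> (dir_deriv \<xi> \<phi>) x + dir_deriv (V x) (dir_deriv (V x) \<phi>) x = 0"
        if "\<xi> \<bullet> V x = 0" "norm \<xi> = norm (V x)" for \<xi>
        using limiting_carleman_weight_Hessian[OF S(1) \<phi> x] that by (simp add: V_def)
    qed
    then show ?thesis by (simp add: V[OF x] k[OF x] w_def)
  qed
  have third: "dir_deriv b' (dir_deriv b (dir_deriv a g)) x = dir_deriv b (dir_deriv b' (dir_deriv a g)) x"
      if "x \<in> S" "smooth_on S g" for x a b b' g
    by (rule dir_deriv_commute[OF S(1) smooth_on_dir_deriv[OF S(1) that(2)] that(1)])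
  have w_V: "dir_deriv (V x) w x = e x * \<kappa> x + dir_deriv (V x) (dir_deriv (V x) f) x" if x: "x \<in> S" for x
    using dir_deriv_inner_diff_covec[OF S(1) sp sf x, of "V x"] HV[OF x, of "k x"]
    by (simp add: w_def[abs_def] V_def k_def \<kappa>_def)
  have Hessf: "dir_deriv b (dir_deriv a f) x = dir_deriv a f x * dir_deriv b f x
      + 2 * \<beta> x * dir_deriv a \<phi> x * dir_deriv b \<phi> x - \<theta> x * (a \<bullet> b)"
    if x: "x \<in> S" for x a b
  proof -
    define A where "A a b = dir_deriv b (dir_deriv a f) x - dir_deriv a f x * dir_deriv b f x" for a b
    define g where "g = diff_covec w x - w x *\<^sub>R k x"
    have dw: "dir_deriv c w x = diff_covec w x \<bullet> c" for c by (simp add: diff_covec_inner[OF S(1) sw x])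
    have H3: "dir_deriv c (dir_deriv b (dir_deriv a \<phi>)) x = dir_deriv a \<phi> x * dir_deriv c (dir_deriv b f) x
        + dir_deriv c (dir_deriv a \<phi>) x * dir_deriv b f x
        + (dir_deriv a f x * dir_deriv c (dir_deriv b \<phi>) x
            + dir_deriv c (dir_deriv a f) x * dir_deriv b \<phi> x) - dir_deriv c w x * (a \<bullet> b)" for a b c
    proof -
      have "dir_deriv c (dir_deriv b (dir_deriv a \<phi>)) x
          = dir_deriv c (\<lambda>x. dir_deriv a \<phi> x * dir_deriv b f x
              + dir_deriv a f x * dir_deriv b \<phi> x - (a \<bullet> b) * w x) x"
        by (rule dir_deriv_cong[OF S(1) x]) (simp add: Hess mult.commute)
      also have "\<dots> = dir_deriv a \<phi> x * dir_deriv c (dir_deriv b f) x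
          + dir_deriv c (dir_deriv a \<phi>) x * dir_deriv b f x
        + (dir_deriv a f x * dir_deriv c (dir_deriv b \<phi>) x
            + dir_deriv c (dir_deriv a f) x * dir_deriv b \<phi> x) - (a \<bullet> b) * dir_deriv c w x"
        by (rule dir_deriv_mult_add_mult_diff[OF S(1) _ _ _ _ _ x]) (intro sm)+
      finally show ?thesis by simp
    qed
    have "A a b = - \<theta> x * (a \<bullet> b) + (2 * \<beta> x) * (V x \<bullet> a) * (V x \<bullet> b)"
    proof (rule symmetric_bilinear_of_Codazzi[OF dim', where g = g])
      show "V x \<noteq> 0" using Vnz[OF x] by (simp add: V_def)
      show "A a b = A b a" for a b by (simp add: A_def dir_deriv_commute[OF S(1) sf x, of a b])
      \<comment> \<open>Subtracting the formula \<open>H3\<close> for the two orders of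
        \<open>b\<close> and \<open>c\<close> cancels everything except the terms with
        \<open>A\<close> and with \<open>g\<close>; this is the vanishing of the curvature of the
        conformal metric on the parallel field.\<close>
      show "A a c * (V x \<bullet> b) - A a b * (V x \<bullet> c)
          = (g \<bullet> c) * (a \<bullet> b) - (g \<bullet> b) * (a \<bullet> c)" for a b c
        using third[OF x sp, of c b a] dir_deriv_commute[OF S(1) sf x, of b c]
        unfolding H3 by (simp add: A_def g_def Hess[OF x] V[OF x] k[OF x] inner_diff_left dw[symmetric]
            inner_commute[of c b] algebra_simps)
      have "A (V x) (V x) = dir_deriv (V x) w x - e x * \<kappa> x - w x * w x"
        using w_V[OF x] k[OF x, of "V x", symmetric] by (simp add: A_def w_def inner_commute)
      moreover have \<beta>e: "\<beta> x * e x * e x = dir_deriv (V x) w x - w x * w x - 1 / 2 * \<kappa> x * e x"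
        using enz[OF x] by (simp add: \<beta>_def dw inner_commute field_simps)
      ultimately show "A (V x) (V x) = - \<theta> x * (V x \<bullet> V x) + 2 * \<beta> x * (V x \<bullet> V x)\<^sup>2"
        by (simp add: \<theta>_def e_def[symmetric] power2_eq_square algebra_simps)
      show "g \<bullet> V x = - (- \<theta> x) * (V x \<bullet> V x)"
        using \<beta>e by (simp add: \<theta>_def g_def inner_diff_left dw[symmetric] w_def[symmetric] e_def[symmetric]
            inner_commute[of "k x" "V x"] algebra_simps)
    qed
    then show ?thesis by (simp add: A_def V[OF x])
  qed
  have d\<beta>: "dir_deriv c \<beta> x = 0" if x: "x \<in> S" for c x
  proof -
    \<comment> \<open>\<open>r c\<close> is the coefficient of \<open>a \<bullet> b\<close> left
      after exchanging \<open>b\<close> and \<open>c\<close> in \<open>K3\<close>. At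
      \<open>V x\<close> it reduces to \<open>- dir_deriv (V x) \<beta> x * e x\<close>, so its
      vanishing kills the one component of the differential of \<beta> that survives.\<close>
    define r where "r c = - dir_deriv c \<theta> x + \<theta> x * dir_deriv c f x
        + 2 * \<beta> x * w x * dir_deriv c \<phi> x" for c
    have K3: "dir_deriv c (dir_deriv b (dir_deriv a f)) x = dir_deriv a f x * dir_deriv c (dir_deriv b f) x
        + dir_deriv c (dir_deriv a f) x * dir_deriv b f x
        + 2 * (\<beta> x * (dir_deriv a \<phi> x * dir_deriv c (dir_deriv b \<phi>) x
            + dir_deriv c (dir_deriv a \<phi>) x * dir_deriv b \<phi> x)
                + dir_deriv c \<beta> x * (dir_deriv a \<phi> x * dir_deriv b \<phi> x))
        - (a \<bullet> b) * dir_deriv c \<theta> x" for a b c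
    proof -
      have t: "dir_deriv c (\<lambda>x. dir_deriv a \<phi> x * dir_deriv b \<phi> x) x
          = dir_deriv a \<phi> x * dir_deriv c (dir_deriv b \<phi>) x
              + dir_deriv c (dir_deriv a \<phi>) x * dir_deriv b \<phi> x"
        by (rule dir_deriv_mult[OF S(1) _ _ x]) (intro sm)+
      have "dir_deriv c (dir_deriv b (dir_deriv a f)) x = dir_deriv c (\<lambda>x. dir_deriv a f x * dir_deriv b f x
          + (2 * \<beta> x) * (dir_deriv a \<phi> x * dir_deriv b \<phi> x) - (a \<bullet> b) * \<theta> x) x"
        by (rule dir_deriv_cong[OF S(1) x]) (simp add: Hessf mult.commute)
      also have "\<dots> = dir_deriv a f x * dir_deriv c (dir_deriv b f) x + dir_deriv c (dir_deriv a f) x * dir_deriv b f x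
        + (2 * \<beta> x * dir_deriv c (\<lambda>x. dir_deriv a \<phi> x * dir_deriv b \<phi> x) x
            + dir_deriv c (\<lambda>x. 2 * \<beta> x) x * (dir_deriv a \<phi> x * dir_deriv b \<phi> x))
        - (a \<bullet> b) * dir_deriv c \<theta> x"
        by (rule dir_deriv_mult_add_mult_diff[OF S(1) _ _ _ _ _ x]) (intro sm)+
      finally show ?thesis unfolding t dir_deriv_cmult[OF S(1) s\<beta> x] by (simp add: algebra_simps)
    qed
    have C: "2 * (V x \<bullet> a) * (dir_deriv c \<beta> x * (V x \<bullet> b) - dir_deriv b \<beta> x * (V x \<bullet> c)) + (a \<bullet> b) * r c - (a \<bullet> c) * r b = 0" for a b c
      using third[OF x sf, of c b a]
      unfolding K3 by (simp add: r_def Hess[OF x] Hessf[OF x] V[OF x] inner_commute[of c b] algebra_simps)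
    have Vx: "V x \<noteq> 0" using Vnz[OF x] by (simp add: V_def)
    note G = gradient_parallel_of_Codazzi[OF dim' Vx, of "\<lambda>c. dir_deriv c \<beta> x" r, OF C]
    have fV: "dir_deriv (V x) f x = w x" and \<phi>V: "dir_deriv (V x) \<phi> x = e x" and fk: "dir_deriv (k x) f x
        = \<kappa> x"
      and \<phi>k: "dir_deriv (k x) \<phi> x = w x"
      by (simp_all add: V[OF x, symmetric] k[OF x, symmetric] w_def e_def \<kappa>_def inner_commute)
    have eV: "dir_deriv (V x) e x = 2 * w x * e x"
      using dir_deriv_inner_diff_covec[OF S(1) sp sp x, of "V x"]
      by (simp add: e_def[abs_def, symmetric] V_def[symmetric] Hess[OF x] fV \<phi>V) (simp add: e_def)
    have \<kappa>V: "dir_deriv (V x) \<kappa> x = 2 * \<theta> x * w x"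
      using dir_deriv_inner_diff_covec[OF S(1) sf sf x, of "V x"]
      by (simp add: \<kappa>_def[abs_def, symmetric] k_def[symmetric] Hessf[OF x] fV \<phi>V fk \<phi>k)
        (simp add: w_def[symmetric] inner_commute[of "k x"] \<theta>_def algebra_simps)
    have "dir_deriv (V x) \<theta> x = 1 / 2 * dir_deriv (V x) \<kappa> x + (\<beta> x * dir_deriv (V x) e x
        + dir_deriv (V x) \<beta> x * e x)"
      unfolding \<theta>_def[abs_def]
      unfolding dir_deriv_cmult[OF S(1) s\<kappa> x, symmetric] dir_deriv_mult[OF S(1) s\<beta> se x, symmetric]
      by (rule dir_deriv_add[OF S(1) _ _ x]) (intro sm)+
    with G(1)[of "V x"] have "dir_deriv (V x) \<beta> x * e x = 0"
      by (simp add: r_def eV \<kappa>V fV \<phi>V algebra_simps)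
    then have "dir_deriv (V x) \<beta> x = 0" using enz[OF x] by simp
    then show ?thesis using G(2)[of c] Vx by simp
  qed
  have "\<exists>c. \<forall>x\<in>S. \<beta> x = c"
    by (rule has_derivative_zero_constant[OF S(2)])
      (use d\<beta> smooth_on_has_derivative[OF S(1) s\<beta>] has_derivative_at_withinI in fastforce)
  then obtain c where c: "\<And>x. x \<in> S \<Longrightarrow> \<beta> x = c" by blast
  have "carleman_system S c \<phi> V f k"
    unfolding carleman_system_def
  proof (intro ballI conjI)
    fix x assume x: "x \<in> S"
    show "V x \<noteq> 0" using Vnz[OF x] by (simp add: V_def)
    show "(\<phi> has_derivative (\<lambda>h. V x \<bullet> h)) (at x)" "(f has_derivative
        (\<lambda>h. k x \<bullet> h)) (at x)"
      unfolding V[OF x] k[OF x] by (intro smooth_on_has_derivative[OF S(1)] sp sf x)+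
    have "diff_covec (dir_deriv h \<phi>) x = (k x \<bullet> h) *\<^sub>R V x
        + (V x \<bullet> h) *\<^sub>R k x - (V x \<bullet> k x) *\<^sub>R h" for h
    proof (subst vector_eq_rdot[symmetric], rule allI)
      fix b
      show "diff_covec (dir_deriv h \<phi>) x \<bullet> b = ((k x \<bullet> h) *\<^sub>R V x
          + (V x \<bullet> h) *\<^sub>R k x - (V x \<bullet> k x) *\<^sub>R h) \<bullet> b"
        unfolding diff_covec_inner[OF S(1) smooth_on_dir_deriv[OF S(1) sp] x] Hess[OF x]
        by (simp add: inner_diff_left inner_add_left V[OF x] k[OF x]) (simp add: w_def V[OF x, symmetric])
    qed
    then show "(V has_derivative (\<lambda>h. (k x \<bullet> h) *\<^sub>R V x
        + (V x \<bullet> h) *\<^sub>R k x - (V x \<bullet> k x) *\<^sub>R h)) (at x)"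
      using diff_covec_has_derivative[OF S(1) sp x] by (simp add: V_def)
    have "diff_covec (dir_deriv h f) x = (k x \<bullet> h) *\<^sub>R k x + (2 * c * (V x \<bullet> h)) *\<^sub>R V x
        - (k x \<bullet> k x / 2 + c * (V x \<bullet> V x)) *\<^sub>R h" for h
    proof (subst vector_eq_rdot[symmetric], rule allI)
      fix b
      show "diff_covec (dir_deriv h f) x \<bullet> b = ((k x \<bullet> h) *\<^sub>R k x
          + (2 * c * (V x \<bullet> h)) *\<^sub>R V x
        - (k x \<bullet> k x / 2 + c * (V x \<bullet> V x)) *\<^sub>R h) \<bullet> b"
        unfolding diff_covec_inner[OF S(1) smooth_on_dir_deriv[OF S(1) sf] x] Hessf[OF x]
        by (simp add: inner_diff_left inner_add_left V[OF x, of b] V[OF x, of h] k[OF x, of b] k[OF x, of h])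
          (simp add: \<theta>_def c[OF x] e_def \<kappa>_def)
    qed
    then show "(k has_derivative (\<lambda>h. (k x \<bullet> h) *\<^sub>R k x + (2 * c * (V x \<bullet> h)) *\<^sub>R V x
        - (k x \<bullet> k x / 2 + c * (V x \<bullet> V x)) *\<^sub>R h)) (at x)"
      using diff_covec_has_derivative[OF S(1) sf x] by (simp add: k_def)
  qed
  then show ?thesis unfolding V_def by blast
qed

section \<open>Quadratic polynomials from solutions of the system\<close>

context
  fixes S :: "(real^'n) set" and c :: real and \<phi> f :: "real^'n \<Rightarrow> real"
      and V k :: "real^'n \<Rightarrow> real^'n"
  assumes sys: "carleman_system S c \<phi> V f k"
begin

lemma carleman_systemD:
  assumes "x \<in> S"
  shows "V x \<noteq> 0" "(\<phi> has_derivative (\<lambda>h. V x \<bullet> h)) (at x)" "(f has_derivative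
      (\<lambda>h. k x \<bullet> h)) (at x)"
    "(V has_derivative (\<lambda>h. (k x \<bullet> h) *\<^sub>R V x
        + (V x \<bullet> h) *\<^sub>R k x - (V x \<bullet> k x) *\<^sub>R h)) (at x)"
    "(k has_derivative (\<lambda>h. (k x \<bullet> h) *\<^sub>R k x + (2 * c * (V x \<bullet> h)) *\<^sub>R V x
        - (k x \<bullet> k x / 2 + c * (V x \<bullet> V x)) *\<^sub>R h)) (at x)"
  using sys assms by (auto simp: carleman_system_def)

text \<open>The differentials of the scalars |k|^2, |V|^2 and V . k are again combinations of
  \<open>k\<close> and \<open>V\<close>: the system is closed, so conserved quantities can be found
  by algebra alone.\<close>

lemma carleman_system_derivs:
  assumes x: "x \<in> S"
  shows "((\<lambda>x. k x \<bullet> h) has_derivative (\<lambda>h'. (k x \<bullet> h') * (k x \<bullet> h)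
      + 2 * c * (V x \<bullet> h') * (V x \<bullet> h)
      - (k x \<bullet> k x / 2 + c * (V x \<bullet> V x)) * (h' \<bullet> h))) (at x)"
    and "((\<lambda>x. V x \<bullet> h) has_derivative (\<lambda>h'. (k x \<bullet> h') * (V x \<bullet> h)
        + (V x \<bullet> h') * (k x \<bullet> h)
      - (V x \<bullet> k x) * (h' \<bullet> h))) (at x)"
    and "((\<lambda>x. k x \<bullet> k x) has_derivative (\<lambda>h. (k x \<bullet> k x) * (k x \<bullet> h)
        + 4 * c * (V x \<bullet> k x) * (V x \<bullet> h)
      - 2 * c * (V x \<bullet> V x) * (k x \<bullet> h))) (at x)"
    and "((\<lambda>x. V x \<bullet> V x) has_derivative (\<lambda>h. 2 * (V x \<bullet> V x) * (k x \<bullet> h))) (at x)"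
    and "((\<lambda>x. V x \<bullet> k x) has_derivative (\<lambda>h. (V x \<bullet> k x) * (k x \<bullet> h)
      + (c * (V x \<bullet> V x) + k x \<bullet> k x / 2) * (V x \<bullet> h))) (at x)"
proof -
  note V' = carleman_systemD(4)[OF x] and k' = carleman_systemD(5)[OF x]
  note inner_simps' = inner_add_left inner_add_right inner_diff_left inner_diff_right inner_commute[of "k x" "V x"]
  show "((\<lambda>x. k x \<bullet> h) has_derivative (\<lambda>h'. (k x \<bullet> h') * (k x \<bullet> h)
      + 2 * c * (V x \<bullet> h') * (V x \<bullet> h)
      - (k x \<bullet> k x / 2 + c * (V x \<bullet> V x)) * (h' \<bullet> h))) (at x)"
    by (rule has_derivative_eq_rhs[OF has_derivative_inner_left[OF k']])
      (simp add: fun_eq_iff inner_simps')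
  show "((\<lambda>x. V x \<bullet> h) has_derivative (\<lambda>h'. (k x \<bullet> h') * (V x \<bullet> h)
      + (V x \<bullet> h') * (k x \<bullet> h)
      - (V x \<bullet> k x) * (h' \<bullet> h))) (at x)"
    by (rule has_derivative_eq_rhs[OF has_derivative_inner_left[OF V']])
      (simp add: fun_eq_iff inner_simps')
  show "((\<lambda>x. k x \<bullet> k x) has_derivative (\<lambda>h. (k x \<bullet> k x) * (k x \<bullet> h)
      + 4 * c * (V x \<bullet> k x) * (V x \<bullet> h)
      - 2 * c * (V x \<bullet> V x) * (k x \<bullet> h))) (at x)"
  proof (rule has_derivative_eq_rhs[OF has_derivative_inner[OF k' k']], rule ext)
    fix h
    show "k x \<bullet> ((k x \<bullet> h) *\<^sub>R k x
        + (2 * c * (V x \<bullet> h)) *\<^sub>R V x - (k x \<bullet> k x / 2 + c * (V x \<bullet> V x)) *\<^sub>R h)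
        + ((k x \<bullet> h) *\<^sub>R k x + (2 * c * (V x \<bullet> h)) *\<^sub>R V x - (k x \<bullet> k x / 2
            + c * (V x \<bullet> V x)) *\<^sub>R h) \<bullet> k x
      = (k x \<bullet> k x) * (k x \<bullet> h)
          + 4 * c * (V x \<bullet> k x) * (V x \<bullet> h) - 2 * c * (V x \<bullet> V x) * (k x \<bullet> h)"
      by (simp add: inner_simps' inner_commute[of h "k x"] algebra_simps)
  qed
  show "((\<lambda>x. V x \<bullet> V x) has_derivative (\<lambda>h. 2 * (V x \<bullet> V x) * (k x \<bullet> h))) (at x)"
  proof (rule has_derivative_eq_rhs[OF has_derivative_inner[OF V' V']], rule ext)
    fix h
    show "V x \<bullet> ((k x \<bullet> h) *\<^sub>R V x + (V x \<bullet> h) *\<^sub>R k x - (V x \<bullet> k x) *\<^sub>R h)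
        + ((k x \<bullet> h) *\<^sub>R V x + (V x \<bullet> h) *\<^sub>R k x - (V x \<bullet> k x) *\<^sub>R h) \<bullet> V x
      = 2 * (V x \<bullet> V x) * (k x \<bullet> h)"
      by (simp add: inner_simps' inner_commute[of h "V x"] algebra_simps)
  qed
  show "((\<lambda>x. V x \<bullet> k x) has_derivative (\<lambda>h. (V x \<bullet> k x) * (k x \<bullet> h)
      + (c * (V x \<bullet> V x) + k x \<bullet> k x / 2) * (V x \<bullet> h))) (at x)"
  proof (rule has_derivative_eq_rhs[OF has_derivative_inner[OF V' k']], rule ext)
    fix h
    show "V x \<bullet> ((k x \<bullet> h) *\<^sub>R k x
        + (2 * c * (V x \<bullet> h)) *\<^sub>R V x - (k x \<bullet> k x / 2 + c * (V x \<bullet> V x)) *\<^sub>R h)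
        + ((k x \<bullet> h) *\<^sub>R V x + (V x \<bullet> h) *\<^sub>R k x - (V x \<bullet> k x) *\<^sub>R h) \<bullet> k x
      = (V x \<bullet> k x) * (k x \<bullet> h) + (c * (V x \<bullet> V x) + k x \<bullet> k x / 2) * (V x \<bullet> h)"
      by (simp add: inner_simps' inner_commute[of h "k x"] algebra_simps)
  qed
qed

text \<open>The field is left general so that the same computation serves real and imaginary
  \<open>s\<close>; this is also why the gradient at \<open>p\<close> is a family \<open>l\<close>
  of scalars and not a vector with an inner product.\<close>

lemma carleman_system_quadric:
  fixes s :: "'b::real_normed_field" and q :: "real^'n \<Rightarrow> 'b"
  assumes S: "convex S" and p: "p \<in> S" and s: "s * s = of_real (2 * c)"
    and q: "\<And>x. x \<in> S \<Longrightarrow>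
      (q has_derivative (\<lambda>h. - q x * (of_real (k x \<bullet> h) + s * of_real (V x \<bullet> h)))) (at x)"
  obtains M l where "(\<Sum>i\<in>UNIV. (l i)\<^sup>2) = M * q p"
    and "\<And>x. x \<in> S \<Longrightarrow>
      q x = M / 4 * of_real ((x - p) \<bullet> (x - p)) + (\<Sum>i\<in>UNIV. l i * of_real ((x - p) $ i)) + q p"
    and "\<And>x h. x \<in> S \<Longrightarrow> - q x * (of_real (k x \<bullet> h) + s * of_real (V x \<bullet> h))
        = M / 2 * of_real ((x - p) \<bullet> h) + (\<Sum>i\<in>UNIV. l i * of_real (h $ i))"
proof -
  define d where "d = 2 * c"
  have s': "s * s = of_real d" using s by (simp add: d_def)
  have ss: "s * (s * y) = 2 * of_real c * y" for y
    using s by (metis mult.assoc of_real_mult of_real_numeral)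
  define A where "A x = k x \<bullet> k x + d * (V x \<bullet> V x)" for x
  define W where "W x = 2 * (V x \<bullet> k x)" for x
  define Y where "Y h x = of_real (k x \<bullet> h) + s * of_real (V x \<bullet> h)" for h x
  define G where "G h x = - q x * Y h x" for h x
  \<comment> \<open>\<open>A x + s W x\<close> is the bilinear square of k + s V. Hence
    \<open>m / 2\<close> is the factor of the identity in the Hessian of \<open>q\<close>, and
    \<open>m\<close> is conserved.\<close>
  define m where "m x = q x * (of_real (A x) + s * of_real (W x))" for x
  have const: "F x = F p" if "x \<in> S" "\<And>x. x \<in> S \<Longrightarrow> (F
      has_derivative (\<lambda>_. 0)) (at x)" for F :: "real^'n \<Rightarrow> 'b" and x
    using has_derivative_zero_unique[OF S, of F x p] that p has_derivative_at_withinI by blast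
  have q': "(q has_derivative (\<lambda>h. - q x * Y h x)) (at x)" if "x \<in> S" for x
    using q[OF that] by (simp add: Y_def)
  have A': "(A has_derivative (\<lambda>h. A x * (k x \<bullet> h) + d * (V x \<bullet> h) * W x)) (at x)"
      if x: "x \<in> S" for x
    unfolding A_def[abs_def]
    by (rule has_derivative_eq_rhs[OF has_derivative_add[OF carleman_system_derivs(3)[OF x]
          has_derivative_mult_right[OF carleman_system_derivs(4)[OF x]]]])
      (simp add: fun_eq_iff W_def d_def algebra_simps)
  have W': "(W has_derivative (\<lambda>h. W x * (k x \<bullet> h) + A x * (V x \<bullet> h))) (at x)"
      if x: "x \<in> S" for x
    unfolding W_def[abs_def]
    by (rule has_derivative_eq_rhs[OF has_derivative_mult_right[OF carleman_system_derivs(5)[OF x]]])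
      (simp add: fun_eq_iff A_def d_def algebra_simps)
  have "(m has_derivative (\<lambda>_. 0)) (at x)" if x: "x \<in> S" for x
    unfolding m_def[abs_def]
    by (rule has_derivative_eq_rhs[OF has_derivative_mult[OF q'[OF x] has_derivative_add[OF
          has_derivative_of_real[OF A'[OF x]] has_derivative_mult_right[OF has_derivative_of_real[OF W'[OF x]]]]]])
      (simp add: fun_eq_iff Y_def s'[symmetric] algebra_simps)
  then have m: "m x = m p" if "x \<in> S" for x using that by (intro const)
  have Y': "(Y h has_derivative (\<lambda>h'. Y h' x * Y h x - (of_real (A x / 2)
      + s * of_real (W x / 2)) * of_real (h' \<bullet> h))) (at x)"
    if x: "x \<in> S" for x h
    unfolding Y_def[abs_def]
    by (rule has_derivative_eq_rhs[OF has_derivative_add[OF has_derivative_of_real[OF carleman_system_derivs(1)[OF x]]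
          has_derivative_mult_right[OF has_derivative_of_real[OF carleman_system_derivs(2)[OF x]]]]])
      (simp add: fun_eq_iff ss A_def W_def d_def field_simps)
  have G': "(G h has_derivative (\<lambda>h'. m x / 2 * of_real (h' \<bullet> h))) (at x)" if x: "x \<in> S" for x h
    unfolding G_def[abs_def]
    by (rule has_derivative_eq_rhs[OF has_derivative_mult[OF has_derivative_minus[OF q'[OF x]] Y'[OF x]]])
      (simp add: fun_eq_iff m_def algebra_simps)
  have linY: "of_real (u \<bullet> h) + s * of_real (v \<bullet> h) =
      (\<Sum>i\<in>UNIV. (of_real (u $ i) + s * of_real (v $ i)) * of_real (h $ i))" for u v h :: "real^'n"
    by (simp add: inner_vec_def sum_distrib_left sum.distrib algebra_simps)
  define M l where "M = m p" and "l i = - q p * (of_real (k p $ i) + s * of_real (V p $ i))" for i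
  have l: "(\<Sum>i\<in>UNIV. l i * of_real (h $ i)) = G h p" for h
    unfolding G_def Y_def linY l_def sum_distrib_left by (simp add: mult.assoc)
  have dp: "((\<lambda>x. x - p) has_derivative (\<lambda>h. h)) (at y)" for y
    by (auto intro!: derivative_eq_intros)
  have dp2: "((\<lambda>x. (x - p) \<bullet> (x - p)) has_derivative (\<lambda>h. 2 * ((y - p) \<bullet> h))) (at y)" for y
    by (rule has_derivative_eq_rhs[OF has_derivative_inner[OF dp dp]])
      (simp add: fun_eq_iff inner_commute)
  have G: "G h x = M / 2 * of_real ((x - p) \<bullet> h) + (\<Sum>i\<in>UNIV. l i * of_real (h $ i))"
      if x: "x \<in> S" for x h
  proof -
    have "((\<lambda>x. G h x - M / 2 * of_real ((x - p) \<bullet> h)) has_derivative (\<lambda>_. 0)) (at y)"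
        if y: "y \<in> S" for y
      by (rule has_derivative_eq_rhs[OF has_derivative_diff[OF G'[OF y, of h, unfolded m[OF y] M_def[symmetric]]
            has_derivative_mult_right[OF has_derivative_of_real[OF has_derivative_inner_left[OF dp]]]]]) simp
    from const[OF x this] show ?thesis unfolding l by (simp add: algebra_simps)
  qed
  have Q: "q x = M / 4 * of_real ((x - p) \<bullet> (x - p)) + (\<Sum>i\<in>UNIV. l i * of_real ((x - p) $ i)) + q p"
    if x: "x \<in> S" for x
  proof -
    have "((\<lambda>x. q x - M / 4 * of_real ((x - p) \<bullet> (x - p)) - (\<Sum>i\<in>UNIV. l i * of_real ((x - p) $ i)))
      has_derivative (\<lambda>_. 0)) (at y)" if y: "y \<in> S" for y
    proof (rule has_derivative_eq_rhs)
      show "((\<lambda>x. q x - M / 4 * of_real ((x - p) \<bullet> (x - p)) - (\<Sum>i\<in>UNIV. l i * of_real ((x - p) $ i)))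
        has_derivative (\<lambda>h. G h y - M / 4 * of_real (2 * ((y - p) \<bullet> h)) - (\<Sum>i\<in>UNIV. l i * of_real (h $ i)))) (at y)"
        unfolding G_def
        by (intro has_derivative_diff q'[OF y] has_derivative_mult_right has_derivative_of_real has_derivative_sum
            bounded_linear.has_derivative[OF bounded_linear_vec_nth] dp dp2)
      show "(\<lambda>h. G h y - M / 4 * of_real (2 * ((y - p) \<bullet> h)) - (\<Sum>i\<in>UNIV. l i * of_real (h $ i))) = (\<lambda>_. 0)"
        using G[OF y] by (simp add: fun_eq_iff)
    qed
    from const[OF x this] show ?thesis by (simp add: algebra_simps)
  qed
  \<comment> \<open>The bilinear square of the gradient at \<open>p\<close> contains the same factor
    as \<open>m p\<close>. This relation later lets the square be completed without
    remainder.\<close>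
  have "(\<Sum>i\<in>UNIV. (l i)\<^sup>2) = (q p)\<^sup>2 * (\<Sum>i\<in>UNIV. (of_real (k p $ i)
      + s * of_real (V p $ i))\<^sup>2)"
    unfolding l_def power_mult_distrib sum_distrib_left by simp
  also have "(\<Sum>i\<in>UNIV. (of_real (k p $ i) + s * of_real (V p $ i))\<^sup>2) = of_real (A p) + s * of_real (W p)"
    by (simp add: A_def W_def inner_vec_def power2_eq_square s'[symmetric] sum_distrib_left sum.distrib algebra_simps)
  also have "(q p)\<^sup>2 * \<dots> = M * q p" by (simp add: M_def m_def power2_eq_square)
  finally have "(\<Sum>i\<in>UNIV. (l i)\<^sup>2) = M * q p" .
  then show thesis
    by (rule that[OF _ Q G[unfolded G_def Y_def]])
qed

end

section \<open>Classification of the solutions\<close>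

lemma arg_of_real_mult: "r > 0 \<Longrightarrow> arg (of_real r * z) = arg z"
  using mult_divide_mult_cancel_left[of r "Im z" "norm z + Re z"]
  by (simp add: arg_def norm_mult distrib_left[symmetric])

text \<open>On the unit circle the quotient in \<open>arg\<close> is sin t / (1 + cos t) = tan (t /
  2), and |t| < pi places t / 2 in the range of \<open>arctan\<close>.\<close>

lemma arg_exp:
  assumes "\<bar>Im z\<bar> < pi" shows "arg (exp z) = Im z"
proof -
  have "arg (exp z) = arg (of_real (exp (Re z)) * cis (Im z))"
    by (simp only: exp_eq_polar[of z])
  also have "\<dots> = arg (cis (Im z))" by (rule arg_of_real_mult) simp
  also have "\<dots> = 2 * arctan (tan (Im z / 2))"
    by (simp add: arg_def tan_half add.commute)
  also have "arctan (tan (Im z / 2)) = Im z / 2"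
    using assms by (intro arctan_tan) (auto simp: abs_less_iff)
  finally show ?thesis by simp
qed

definition affine_model :: "(real^'n \<Rightarrow> real) \<Rightarrow> (real^'n) set \<Rightarrow> bool" where
  "affine_model \<phi> U \<longleftrightarrow> (\<exists>a b x\<^sub>0 \<phi>\<^sub>0 D. a \<noteq> 0
      \<and> model_weight \<phi>\<^sub>0 D \<and>
     (\<forall>x\<in>U. x - x\<^sub>0 \<in> D \<and> \<phi> x = a * \<phi>\<^sub>0 (x - x\<^sub>0) + b))"

lemma affine_modelI:
  assumes "model_weight \<phi>\<^sub>0 D" "a \<noteq> 0" "\<And>x. x \<in> U \<Longrightarrow> x - x\<^sub>0 \<in> D"
    "\<And>x. x \<in> U \<Longrightarrow> \<phi> x = a * \<phi>\<^sub>0 (x - x\<^sub>0) + b"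
  shows "affine_model \<phi> U"
  unfolding affine_model_def
  by (intro exI[of _ a] exI[of _ b] exI[of _ x\<^sub>0] exI[of _ \<phi>\<^sub>0] exI[of _ D] conjI ballI assms)

section \<open>Weights for each sign of the constant\<close>

context
  fixes S :: "(real^'n) set" and c :: real and \<phi> f :: "real^'n \<Rightarrow> real"
      and V k :: "real^'n \<Rightarrow> real^'n"
    and p :: "real^'n"
  assumes sys: "carleman_system S c \<phi> V f k" and S: "open S" "convex S" and p: "p \<in> S"
begin

lemma carleman_system_not_constant:
  assumes "open U" "p \<in> U" "U \<subseteq> S"
  shows "\<exists>x\<in>U. \<phi> x \<noteq> \<phi> p"
proof (rule ccontr)
  assume "\<not> ?thesis"
  then have "(\<phi> has_derivative (\<lambda>_. 0)) (at p)"
    using has_derivative_cong_open[OF assms(1,2), of \<phi> "\<lambda>_. \<phi> p"] by auto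
  from fun_cong[OF has_derivative_unique[OF this carleman_systemD(2)[OF sys p]], of "V p"]
  have "V p \<bullet> V p = 0" by simp
  then show False using carleman_systemD(1)[OF sys p] by simp
qed

lemma exp_has_derivative_system:
  fixes s :: "'b::{real_normed_field, banach}"
  assumes x: "x \<in> S"
  defines "q \<equiv> \<lambda>x. exp (- of_real (f x - f p) - s * of_real (\<phi> x - \<phi> p))"
  shows "(q has_derivative (\<lambda>h. - q x * (of_real (k x \<bullet> h) + s * of_real (V x \<bullet> h)))) (at x)"
proof -
  have "((\<lambda>x. - of_real (f x - f p) - s * of_real (\<phi> x - \<phi> p)) has_derivative
      (\<lambda>h. - of_real (k x \<bullet> h) - s * of_real (V x \<bullet> h))) (at x)"
    by (auto intro!: derivative_eq_intros carleman_systemD[OF sys x])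
  from has_derivative_compose[OF this DERIV_exp[unfolded has_field_derivative_def]]
  show ?thesis unfolding q_def by (simp add: algebra_simps)
qed

text \<open>Over the reals \<open>M\<close> is the squared length of the gradient of
  \<open>q\<close> at \<open>p\<close>, because \<open>q p = 1\<close>. So either the gradient
  vanishes and \<open>q\<close> is constant, or \<open>M > 0\<close> and \<open>q\<close> is a
  perfect square. The formulas for k + s V integrate the case \<open>s = 0\<close>.\<close>

lemma carleman_system_real_quadric:
  fixes s :: real
  assumes s: "s * s = 2 * c"
  defines "q \<equiv> \<lambda>x. exp (- (f x - f p) - s * (\<phi> x - \<phi> p))"
  shows "(\<forall>x\<in>S. q x = 1 \<and> k x = - s *\<^sub>R V x) \<or>
    (\<exists>A>0. \<exists>z. \<forall>x\<in>S. x \<noteq> z \<and> q x = A * (norm (x - z))\<^sup>2 \<and>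
       (norm (x - z))\<^sup>2 *\<^sub>R (k x + s *\<^sub>R V x) = - 2 *\<^sub>R (x - z))"
proof -
  have q: "q x > 0" for x by (simp add: q_def)
  have qp: "q p = 1" by (simp add: q_def)
  have s': "s * s = of_real (2 * c)" using s by simp
  have q': "(q has_derivative (\<lambda>h. - q x * (of_real (k x \<bullet> h)
      + s * of_real (V x \<bullet> h)))) (at x)" if "x \<in> S" for x
    using exp_has_derivative_system[OF that, of s] by (simp add: q_def)
  obtain M l where ll: "(\<Sum>i\<in>UNIV. (l i)\<^sup>2) = M * q p"
    and Q: "\<And>x. x \<in> S \<Longrightarrow>
      q x = M / 4 * of_real ((x - p) \<bullet> (x - p)) + (\<Sum>i\<in>UNIV. l i * of_real ((x - p) $ i)) + q p"
    and G: "\<And>x h. x \<in> S \<Longrightarrow> - q x * (of_real (k x \<bullet> h) + s * of_real (V x \<bullet> h))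
        = M / 2 * of_real ((x - p) \<bullet> h) + (\<Sum>i\<in>UNIV. l i * of_real (h $ i))"
    by (rule carleman_system_quadric[OF sys S(2) p s' q'], assumption) (rule that)
  define u where "u = (\<chi> i. l i)"
  have l: "(\<Sum>i\<in>UNIV. l i * of_real (h $ i)) = u \<bullet> h" for h by (simp add: u_def inner_vec_def)
  note Q = Q[unfolded l] and G = G[unfolded l]
  have uu: "u \<bullet> u = M" using ll qp by (simp add: u_def inner_vec_def power2_eq_square)
  show ?thesis
  proof (cases "M = 0")
    case True
    then have "u = 0" using uu by simp
    then have "q x = 1 \<and> k x = - s *\<^sub>R V x" if "x \<in> S" for x
    proof -
      have "(k x + s *\<^sub>R V x) \<bullet> h = 0" for h
        using G[OF that, of h] q[of x] True \<open>u = 0\<close> by (simp add: inner_add_left)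
      then have "k x + s *\<^sub>R V x = 0" using inner_eq_zero_iff by blast
      then show ?thesis using Q[OF that] True \<open>u = 0\<close> qp by (simp add: eq_neg_iff_add_eq_0)
    qed
    then show ?thesis by blast
  next
    case False
    then have M: "M > 0" using uu by (metis inner_ge_zero less_eq_real_def)
    \<comment> \<open>The centre from completing the square; \<open>u \<bullet> u = M\<close> makes
      the constant term vanish exactly.\<close>
    define z where "z = p - (2 / M) *\<^sub>R u"
    have xz: "x - p = (x - z) - (2 / M) *\<^sub>R u" for x by (simp add: z_def)
    have square: "M / 4 * ((y - (2 / M) *\<^sub>R u) \<bullet> (y - (2 / M) *\<^sub>R u))
        + u \<bullet> (y - (2 / M) *\<^sub>R u) + 1 = M / 4 * (y \<bullet> y)" for y
      using M by (simp add: inner_diff_left inner_diff_right inner_commute[of y u] uu field_simps)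
    have lin: "M / 2 * ((y - (2 / M) *\<^sub>R u) \<bullet> h) + u \<bullet> h = M / 2 * (y \<bullet> h)" for y h
      using M by (simp add: inner_diff_left field_simps)
    have qz: "q x = M / 4 * (norm (x - z))\<^sup>2" if "x \<in> S" for x
      unfolding Q[OF that] qp xz power2_norm_eq_inner by (simp only: of_real_eq_id id_apply square)
    moreover have "x \<noteq> z" if "x \<in> S" for x using qz[OF that] q[of x] by auto
    moreover have "(norm (x - z))\<^sup>2 *\<^sub>R (k x + s *\<^sub>R V x) = - 2 *\<^sub>R (x - z)" if x: "x \<in> S" for x
    proof (subst vector_eq_rdot[symmetric], rule allI)
      fix h
      have "- (M / 4 * (norm (x - z))\<^sup>2) * (k x \<bullet> h + s * (V x \<bullet> h)) = M / 2 * ((x - z) \<bullet> h)"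
        using G[OF x, of h] unfolding qz[OF x] xz by (simp only: of_real_eq_id id_apply lin)
      then have "M * ((norm (x - z))\<^sup>2 * (k x \<bullet> h + s * (V x \<bullet> h)))
          = M * (- 2 * ((x - z) \<bullet> h))"
        by (simp add: field_simps)
      then have "(norm (x - z))\<^sup>2 * (k x \<bullet> h + s * (V x \<bullet> h)) = - 2 * ((x - z) \<bullet> h)"
        using M by (metis mult_left_cancel less_irrefl)
      then show "(norm (x - z))\<^sup>2 *\<^sub>R (k x + s *\<^sub>R V x) \<bullet> h = - 2 *\<^sub>R (x - z) \<bullet> h"
        by (simp add: inner_add_left inner_diff_left)
    qed
    ultimately show ?thesis using M by (intro disjI2 exI[of _ "M / 4"] conjI exI[of _ z]) auto
  qed
qed

text \<open>In the quotient of the functions for -s and s the factor exp (- f) cancels and exp (2 s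
  \<phi>) remains up to a constant. One constant factor gives \<open>log_norm\<close>, two distinct
  centres give \<open>log_quotient\<close>; the other combinations would make \<phi>
  constant.\<close>

lemma carleman_system_positive:
  assumes c: "c > 0"
  shows "affine_model \<phi> S"
proof -
  define q where "q s x = exp (- (f x - f p) - s * (\<phi> x - \<phi> p))" for s x
  have quot: "2 * s * (\<phi> x - \<phi> p) = ln (q (- s) x) - ln (q s x)" for s x
    by (simp add: q_def)
  have cases: "(\<forall>x\<in>S. q s x = 1) \<or> (\<exists>A>0. \<exists>z. \<forall>x\<in>S. x \<noteq> z
      \<and> q s x = A * (norm (x - z))\<^sup>2)"
    if "s * s = 2 * c" for s
    using carleman_system_real_quadric[OF that] unfolding q_def by blast
  have nonconst: "\<exists>x\<in>S. \<phi> x \<noteq> \<phi> p" using carleman_system_not_constant[OF S(1) p] by blast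
  \<comment> \<open>Stated for either sign of \<open>s\<close>, since the two mixed cases are
    exchanged by \<open>s\<close> going to \<open>- s\<close>.\<close>
  have one: ?thesis
    if s: "s \<noteq> 0" and "\<forall>x\<in>S. q s x = 1" and "A > 0" and z: "\<forall>x\<in>S. x \<noteq> z
        \<and> q (- s) x = A * (norm (x - z))\<^sup>2" for s A z
  proof -
    have "\<phi> x = (1 / s) * ln (norm (x - z)) + (\<phi> p + ln A / (2 * s))" if x: "x \<in> S" for x
    proof -
      have "2 * s * (\<phi> x - \<phi> p) = ln A + 2 * ln (norm (x - z))"
        using quot[of s x] that \<open>A > 0\<close> z \<open>\<forall>x\<in>S. q s x = 1\<close>
            by (simp add: ln_mult ln_realpow)
      then show ?thesis using s by (simp add: field_simps)
    qed
    then show ?thesis using s z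
      by (intro affine_modelI[OF model_weight.log_norm, of "1 / s" S z]) auto
  qed
  define s where "s = sqrt (2 * c)"
  have "s * s = 2 * c"
    unfolding s_def using real_sqrt_pow2[of "2 * c"] c unfolding power2_eq_square by linarith
  then have s: "s \<noteq> 0" "s * s = 2 * c" "(- s) * (- s) = 2 * c" using c by auto
  from cases[OF s(2)] cases[OF s(3)] show ?thesis
  proof (elim disjE exE conjE)
    assume "\<forall>x\<in>S. q s x = 1" "\<forall>x\<in>S. q (- s) x = 1"
    then have "\<phi> x = \<phi> p" if "x \<in> S" for x using quot[of s x] s(1) that by simp
    then show ?thesis using nonconst by blast
  next
    fix A z assume "\<forall>x\<in>S. q s x = 1" "A > 0" "\<forall>x\<in>S. x \<noteq> z \<and> q (- s) x
        = A * (norm (x - z))\<^sup>2"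
    then show ?thesis by (rule one[OF s(1)])
  next
    fix A z assume "\<forall>x\<in>S. q (- s) x = 1" "A > 0" "\<forall>x\<in>S. x \<noteq> z \<and> q s x
        = A * (norm (x - z))\<^sup>2"
    then show ?thesis using s(1) by (intro one[of "- s" A z]) simp_all
  next
    fix A z B y assume AB: "A > 0" "B > 0" and z: "\<forall>x\<in>S. x \<noteq> z \<and> q s x = A * (norm (x - z))\<^sup>2"
      and y: "\<forall>x\<in>S. x \<noteq> y \<and> q (- s) x = B * (norm (x - y))\<^sup>2"
    have *: "2 * s * (\<phi> x - \<phi> p) = ln (B / A) + ln ((norm (x - y))\<^sup>2 / (norm (x - z))\<^sup>2)"
        if x: "x \<in> S" for x
      using quot[of s x] AB y z x by (simp add: ln_mult ln_div ln_realpow)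
    have "y \<noteq> z"
    proof
      assume "y = z"
      then have "2 * s * (\<phi> x - \<phi> p) = 2 * s * (\<phi> p - \<phi> p)" if "x \<in> S" for x
        using *[OF that] *[OF p] AB y z that p by simp
      then show False using nonconst s(1) by auto
    qed
    define x\<^sub>0 \<xi> where "x\<^sub>0 = (1 / 2) *\<^sub>R (y + z)" and "\<xi> = (1 / 2) *\<^sub>R (z - y)"
    have e: "x - x\<^sub>0 + \<xi> = x - y" "x - x\<^sub>0 - \<xi> = x - z" for x
      by (simp_all add: x\<^sub>0_def \<xi>_def vec_eq_iff field_simps)
    have "model_weight (\<lambda>x. ln ((norm (x + \<xi>))\<^sup>2 / (norm (x - \<xi>))\<^sup>2)) (- {\<xi>, - \<xi>})"
      using \<open>y \<noteq> z\<close> by (intro model_weight.log_quotient) (simp add: \<xi>_def)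
    moreover have "x - x\<^sub>0 \<in> - {\<xi>, - \<xi>}" if "x \<in> S" for x
    proof -
      have "x - x\<^sub>0 + \<xi> \<noteq> 0" "x - x\<^sub>0 - \<xi> \<noteq> 0" unfolding e using y z that by auto
      then show ?thesis by (auto simp: eq_neg_iff_add_eq_0)
    qed
    moreover have "\<phi> x = 1 / (2 * s) * ln ((norm (x - x\<^sub>0
        + \<xi>))\<^sup>2 / (norm (x - x\<^sub>0 - \<xi>))\<^sup>2) + (\<phi> p + ln (B / A) / (2 * s))"
      if "x \<in> S" for x
    proof -
      have "\<phi> x - \<phi> p = (ln (B / A) + ln ((norm (x - y))\<^sup>2 / (norm (x - z))\<^sup>2)) / (2 * s)"
        using *[OF that] s(1) by (simp add: nonzero_eq_divide_eq mult.commute)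
      then show ?thesis unfolding e by (simp add: add_divide_distrib algebra_simps)
    qed
    ultimately show ?thesis using s(1) by (intro affine_modelI[of _ _ "1 / (2 * s)" S x\<^sub>0]) auto
  qed
qed

text \<open>With \<open>s = 0\<close> the dichotomy for \<open>q\<close> describes \<open>k\<close>
  alone: either \<open>k = 0\<close> and \<open>V\<close> is constant, or inversion about
  \<open>z\<close> reduces \<phi> to an affine function.\<close>

lemma carleman_system_zero:
  assumes c: "c = 0"
  shows "affine_model \<phi> S"
proof -
  have const: "F x = F p" if "x \<in> S" "\<And>x. x \<in> S \<Longrightarrow> (F has_derivative (\<lambda>_. 0)) (at x)"
    for F :: "real^'n \<Rightarrow> 'b::real_normed_vector" and x
    using has_derivative_zero_unique[OF S(2), of F x p] that p has_derivative_at_withinI by blast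
  have Vp: "V p \<noteq> 0" using carleman_systemD(1)[OF sys p] .
  note V' = carleman_systemD(4)[OF sys] and \<phi>' = carleman_systemD(2)[OF sys]
  have "(0::real) * 0 = 2 * c" using c by simp
  from carleman_system_real_quadric[OF this]
  consider "\<forall>x\<in>S. k x = 0" | z where "\<forall>x\<in>S. x \<noteq> z
      \<and> (norm (x - z))\<^sup>2 *\<^sub>R k x = - 2 *\<^sub>R (x - z)" by auto
  then show ?thesis
  proof cases
    case 1
    have "(V has_derivative (\<lambda>_. 0)) (at x)" if "x \<in> S" for x using V'[OF that] 1 that by simp
    then have V: "V x = V p" if "x \<in> S" for x using that by (intro const)
    have "((\<lambda>x. \<phi> x - x \<bullet> V p) has_derivative (\<lambda>_. 0)) (at x)" if "x \<in> S" for x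
      using \<phi>'[OF that] unfolding V[OF that] by (auto intro!: derivative_eq_intros simp: inner_commute)
    then have "\<phi> x - x \<bullet> V p = \<phi> p - p \<bullet> V p" if "x \<in> S" for x
      using const[OF that, of "\<lambda>x. \<phi> x - x \<bullet> V p"] by simp
    then have "\<phi> x = 1 * ((x - 0) \<bullet> V p) + (\<phi> p - p \<bullet> V p)" if "x \<in> S" for x
      using that by (metis add.commute diff_add_cancel diff_zero mult_1)
    then show ?thesis 
      by (intro affine_modelI[OF model_weight.linear[OF Vp], of 1 S 0]) auto
  next
    case (2 z)
    \<comment> \<open>\<open>b x\<close> is the gradient of \<phi> composed with the inversion about
      \<open>z\<close>, taken at the inverted point: |x - z|^2 times the reflection of
      \<open>V x\<close> along \<open>x - z\<close>. Its constancy says that the composition is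
      affine.\<close>
    define b where "b x = (norm (x - z))\<^sup>2 *\<^sub>R V x - (2 * (V x \<bullet> (x - z))) *\<^sub>R (x - z)" for x
    have xz: "x \<noteq> z" if "x \<in> S" for x using 2 that by blast
    have "(b has_derivative (\<lambda>_. 0)) (at x)" if x: "x \<in> S" for x
    proof -
      define y where "y = x - z"
      have y: "y \<bullet> y > 0" using xz[OF x] by (simp add: y_def)
      have dz: "((\<lambda>x. x - z) has_derivative (\<lambda>h. h)) (at x)" by (auto intro!: derivative_eq_intros)
      define dV where "dV h = (k x \<bullet> h) *\<^sub>R V x
          + (V x \<bullet> h) *\<^sub>R k x - (V x \<bullet> k x) *\<^sub>R h" for h
      have k: "(y \<bullet> y) *\<^sub>R k x = - 2 *\<^sub>R y" using 2 x by (simp add: y_def power2_norm_eq_inner)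
      have ky: "(y \<bullet> y) * (k x \<bullet> h) = - 2 * (y \<bullet> h)" for h
        using arg_cong[OF k, of "\<lambda>v. v \<bullet> h"] by simp
      have dV: "(y \<bullet> y) *\<^sub>R dV h
          = (- 2 * (y \<bullet> h)) *\<^sub>R V x - (2 * (V x \<bullet> h)) *\<^sub>R y
              + (2 * (V x \<bullet> y)) *\<^sub>R h" for h
      proof -
        have "(y \<bullet> y) *\<^sub>R dV h = ((y \<bullet> y) * (k x \<bullet> h)) *\<^sub>R V x
            + (V x \<bullet> h) *\<^sub>R ((y \<bullet> y) *\<^sub>R k x) - ((y \<bullet> y) * (k x \<bullet> V x)) *\<^sub>R h"
          by (simp add: dV_def algebra_simps inner_commute)
        then show ?thesis unfolding k ky by (simp add: inner_commute algebra_simps)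
      qed
      have "(y \<bullet> y) * (dV h \<bullet> y) = (y \<bullet> y) * (- 2 * (V x \<bullet> h))" for h
        using arg_cong[OF dV, of "\<lambda>v. v \<bullet> y" h]
            by (simp add: inner_add_left inner_diff_left inner_commute[of h y] algebra_simps)
      then have dVy: "dV h \<bullet> y = - 2 * (V x \<bullet> h)" for h using y by (metis mult_cancel_left less_irrefl)
      have "(b has_derivative (\<lambda>h. (y \<bullet> y) *\<^sub>R dV h + (y \<bullet> h + h \<bullet> y) *\<^sub>R V x
          - ((2 * (V x \<bullet> y)) *\<^sub>R h + (2 * (V x \<bullet> h + dV h \<bullet> y)) *\<^sub>R y))) (at x)"
        unfolding b_def[abs_def] power2_norm_eq_inner y_def dV_def
        by (intro has_derivative_diff has_derivative_scaleR has_derivative_mult_right has_derivative_inner dz V'[OF x])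
      then show ?thesis
        unfolding dV dVy by (simp add: inner_commute[of _ y] algebra_simps)
    qed
    then have b: "b x = b p" if "x \<in> S" for x using that by (intro const)
    \<comment> \<open>The reflection is its own inverse, which recovers \<open>V\<close> from
      \<open>b\<close>.\<close>
    have bV: "(norm (x - z))\<^sup>2 *\<^sub>R V x
        = b p - (2 * (b p \<bullet> (x - z)) / (norm (x - z))\<^sup>2) *\<^sub>R (x - z)" if x: "x \<in> S" for x
    proof -
      have n: "(norm (x - z))\<^sup>2 \<noteq> 0" using xz[OF x] by simp
      have "b x \<bullet> (x - z) = - (norm (x - z))\<^sup>2 * (V x \<bullet> (x - z))"
        by (simp add: b_def inner_diff_left power2_norm_eq_inner[symmetric])
      then have "2 * (b x \<bullet> (x - z)) / (norm (x - z))\<^sup>2 = - 2 * (V x \<bullet> (x - z))"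
        using n by (simp add: field_simps)
      then show ?thesis unfolding b[OF x, symmetric] by (simp add: b_def)
    qed
    have bp: "b p \<noteq> 0"
      using bV[OF p] Vp xz[OF p] by auto
    have "((\<lambda>x. \<phi> x - ((x - z) \<bullet> b p) / (norm (x - z))\<^sup>2)
        has_derivative (\<lambda>_. 0)) (at x)" if x: "x \<in> S" for x
    proof -
      define N where "N = (norm (x - z))\<^sup>2"
      have N: "N \<noteq> 0" using xz[OF x] by (simp add: N_def)
      have dz: "((\<lambda>x. x - z) has_derivative (\<lambda>h. h)) (at x)" by (auto intro!: derivative_eq_intros)
      have "((\<lambda>x. \<phi> x - ((x - z) \<bullet> b p) / (norm (x - z))\<^sup>2) has_derivative
        (\<lambda>h. V x \<bullet> h - (- ((x - z) \<bullet> b p) * (inverse N * ((x - z) \<bullet> h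
            + h \<bullet> (x - z)) * inverse N) + (h \<bullet> b p) / N))) (at x)"
        unfolding power2_norm_eq_inner N_def using xz[OF x]
        by (intro has_derivative_diff \<phi>'[OF x] has_derivative_divide has_derivative_inner
            has_derivative_inner_left dz) auto
      moreover have "V x \<bullet> h - (- ((x - z) \<bullet> b p) * (inverse N * ((x - z) \<bullet> h
          + h \<bullet> (x - z)) * inverse N) + (h \<bullet> b p) / N) = 0" for h
      proof -
        have "N * (V x \<bullet> h) = b p \<bullet> h - 2 * (b p \<bullet> (x - z)) / N * ((x - z) \<bullet> h)"
          using arg_cong[OF bV[OF x], of "\<lambda>v. v \<bullet> h"] by (simp add: N_def inner_diff_left)
        then have "V x \<bullet> h = (b p \<bullet> h - 2 * (b p \<bullet> (x - z)) / N * ((x - z) \<bullet> h)) / N"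
          using N by (metis nonzero_mult_div_cancel_left)
        then show ?thesis using N
          by (simp add: inner_commute[of h] inner_commute[of "x - z" "b p"] divide_simps)
      qed
      ultimately show ?thesis by (simp only:)
    qed
    then have E: "\<phi> x - ((x - z) \<bullet> b p) / (norm (x - z))\<^sup>2
        = \<phi> p - ((p - z) \<bullet> b p) / (norm (p - z))\<^sup>2" if "x \<in> S" for x
      using const[OF that, of "\<lambda>x. \<phi> x - ((x - z) \<bullet> b p) / (norm (x - z))\<^sup>2"] by simp
    have "\<phi> x = 1 * (((x - z) \<bullet> b p) / (norm (x - z))\<^sup>2)
        + (\<phi> p - ((p - z) \<bullet> b p) / (norm (p - z))\<^sup>2)" if "x \<in> S" for x
      unfolding E[OF that, symmetric] by simp
    then show ?thesis using xz
      by (intro affine_modelI[OF model_weight.inverted_linear[OF bp], of 1 S z]) auto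
  qed
qed

end

text \<open>With imaginary \<open>s\<close> the modulus of \<open>q\<close> carries \<open>f\<close>
  and its phase carries \<phi>, so the argument of the polynomial recovers \<phi> while the phase
  stays in one branch.\<close>

lemma carleman_system_negative:
  fixes S :: "(real^'n) set"
  assumes sys: "carleman_system S c \<phi> V f k" and S: "open S" "convex S" and p: "p \<in> S" and c: "c < 0"
  shows "\<exists>U. open U \<and> p \<in> U \<and> U \<subseteq> S \<and> affine_model \<phi> U"
proof -
  define \<sigma> where "\<sigma> = sqrt (- 2 * c)"
  have \<sigma>: "\<sigma> > 0" using c by (simp add: \<sigma>_def)
  have "\<sigma> * \<sigma> = - 2 * c"
    unfolding \<sigma>_def using real_sqrt_pow2[of "- 2 * c"] c unfolding power2_eq_square by linarith
  then have s: "(\<i> * of_real \<sigma>) * (\<i> * of_real \<sigma>) = (of_real (2 * c) :: complex)"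
    by (simp add: complex_eq_iff)
  define q where "q x = exp (- of_real (f x - f p) - (\<i> * of_real \<sigma>) * of_real (\<phi> x - \<phi> p))" for x
  have qp: "q p = 1" by (simp add: q_def)
  have q': "(q has_derivative (\<lambda>h. - q x * (of_real (k x \<bullet> h)
      + (\<i> * of_real \<sigma>) * of_real (V x \<bullet> h)))) (at x)"
    if "x \<in> S" for x
    using exp_has_derivative_system[OF sys S p that] unfolding q_def[abs_def] .
  obtain M l where ll: "(\<Sum>i\<in>UNIV. (l i)\<^sup>2) = M * q p"
    and Q: "\<And>x. x \<in> S \<Longrightarrow>
      q x = M / 4 * of_real ((x - p) \<bullet> (x - p)) + (\<Sum>i\<in>UNIV. l i * of_real ((x - p) $ i)) + q p"
    by (rule carleman_system_quadric[OF sys S(2) p s q'], assumption) (rule that)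
  \<comment> \<open>The bound pi / 2 on the phase makes the real part of \<open>q\<close> positive,
    which keeps \<open>q\<close> and its positive multiples off the cut.\<close>
  define U where "U = S \<inter> (\<lambda>x. \<sigma> * (\<phi> x - \<phi> p)) -` {- (pi / 2) <..< pi / 2}"
  have cont: "continuous_on S \<phi>"
    by (rule has_derivative_continuous_on[OF has_derivative_at_withinI[OF carleman_systemD(2)[OF sys]]])
  have "open U"
    unfolding U_def by (rule continuous_open_preimage) (intro continuous_intros cont S open_greaterThanLessThan)+
  moreover have "p \<in> U" "U \<subseteq> S" using p by (simp_all add: U_def)
  ultimately have U: "open U" "p \<in> U" "U \<subseteq> S" by blast+
  have phase: "\<bar>\<sigma> * (\<phi> x - \<phi> p)\<bar> < pi / 2" if "x \<in> U" for x
    using that unfolding U_def by auto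
  have arg_q: "\<phi> x = - (1 / \<sigma>) * arg (q x) + \<phi> p" if "x \<in> U" for x
  proof -
    have "arg (q x) = - (\<sigma> * (\<phi> x - \<phi> p))"
      using phase[OF that] pi_gt_zero unfolding q_def by (subst arg_exp) auto
    then show ?thesis using \<sigma> by (simp add: field_simps)
  qed
  have Re_q: "Re (q x) > 0" if "x \<in> U" for x
    using phase[OF that] unfolding q_def Re_exp by (auto intro!: mult_pos_pos cos_gt_zero_pi)
  obtain y where y: "y \<in> U" "\<phi> y \<noteq> \<phi> p"
    using carleman_system_not_constant[OF sys S p U] by blast
  \<comment> \<open>A point where \<phi> differs from its value at \<open>p\<close> has nonzero
    phase; this will exclude \<open>v = 0\<close> and \<open>\<xi> = 0\<close>.\<close>
  have not_real: "Im (q y) \<noteq> 0"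
  proof
    assume "Im (q y) = 0"
    then have "arg (q y) = 0" by (simp add: arg_def)
    then show False using arg_q[OF y(1)] y(2) by simp
  qed
  define u v where "u = (\<chi> i. Re (l i))" and "v = (\<chi> i. Im (l i))"
  have l: "(\<Sum>i\<in>UNIV. l i * of_real (h $ i)) = Complex (u \<bullet> h) (v \<bullet> h)" for h
    by (simp add: complex_eq_iff u_def v_def inner_vec_def)
  have lsq: "Complex (u \<bullet> u - v \<bullet> v) (2 * (u \<bullet> v)) = M"
    using ll qp by (simp add: complex_eq_iff u_def v_def inner_vec_def power2_eq_square sum_subtractf
        sum.distrib sum_distrib_left mult.commute)
  have "affine_model \<phi> U"
  proof (cases "M = 0")
    case True
    then have uv: "u \<bullet> u = v \<bullet> v" "u \<bullet> v = 0" using lsq by (auto simp: complex_eq_iff)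
    have qx: "q x = Complex (u \<bullet> (x - p) + 1) (v \<bullet> (x - p))" if "x \<in> U" for x
      using Q[of x] that U(3) True qp unfolding l by (auto simp: complex_eq_iff)
    have "v \<noteq> 0" using not_real qx[OF y(1)] by auto
    define \<rho> where "\<rho> = norm v"
    have \<rho>: "\<rho> > 0" "u \<bullet> u = \<rho> * \<rho>" "norm u = \<rho>" using \<open>v \<noteq> 0\<close> uv
      by (simp_all add: \<rho>_def norm_eq_sqrt_inner)
    \<comment> \<open>For \<open>M = 0\<close> the gradient is a null vector, so \<open>u\<close>
      and \<open>v\<close> are orthogonal of equal length. Moving the origin along \<open>u\<close>
      absorbs the value 1 of \<open>q\<close> at \<open>p\<close> and leaves the imaginary part
      unchanged.\<close>
    define \<omega>\<^sub>1 \<omega>\<^sub>2 x\<^sub>0 where "\<omega>\<^sub>1 = (1 / \<rho>) *\<^sub>R u"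
        and "\<omega>\<^sub>2 = (1 / \<rho>) *\<^sub>R v" and "x\<^sub>0 = p - (1 / (\<rho> * \<rho>)) *\<^sub>R u"
    have xp: "x - p = (x - x\<^sub>0) - (1 / (\<rho> * \<rho>)) *\<^sub>R u" for x by (simp add: x\<^sub>0_def)
    have q_eq: "q x = of_real \<rho> * cdot (cvec (x - x\<^sub>0) 0) (cvec \<omega>\<^sub>1 \<omega>\<^sub>2)"
        if "x \<in> U" for x
    proof -
      have "u \<bullet> (z - (1 / (\<rho> * \<rho>)) *\<^sub>R u) + 1
          = z \<bullet> u" "v \<bullet> (z - (1 / (\<rho> * \<rho>)) *\<^sub>R u) = z \<bullet> v" for z
        using \<rho> uv by (simp_all add: inner_diff_right inner_commute[of u z] inner_commute[of v u] inner_commute[of v z])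
      then show ?thesis
        using \<rho> unfolding qx[OF that] xp cdot_real_left \<omega>\<^sub>1_def \<omega>\<^sub>2_def
        by (simp only: complex_eq_iff) simp
    qed
    show ?thesis
    proof (rule affine_modelI[OF model_weight.arg_linear[of \<omega>\<^sub>1 \<omega>\<^sub>2], of "- (1 / \<sigma>)" U x\<^sub>0 \<phi> "\<phi> p"])
      show "norm \<omega>\<^sub>1 = 1" "norm \<omega>\<^sub>2 = 1" "\<omega>\<^sub>1 \<bullet> \<omega>\<^sub>2 = 0"
        using \<rho> uv by (simp_all add: \<omega>\<^sub>1_def \<omega>\<^sub>2_def) (simp add: \<rho>_def)
      show "- (1 / \<sigma>) \<noteq> 0" using \<sigma> by simp
      fix x assume x: "x \<in> U"
      show "x - x\<^sub>0 \<in> {x. cdot (cvec x 0) (cvec \<omega>\<^sub>1 \<omega>\<^sub>2) \<notin> \<real>\<^sub>\<le>\<^sub>0}"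
        using Re_q[OF x] \<rho>(1) unfolding q_eq[OF x] by (auto simp: complex_nonpos_Reals_iff zero_less_mult_iff)
      show "\<phi> x = - (1 / \<sigma>) * arg (cdot (cvec (x - x\<^sub>0) 0) (cvec \<omega>\<^sub>1 \<omega>\<^sub>2))
          + \<phi> p"
        using arg_q[OF x] unfolding q_eq[OF x] arg_of_real_mult[OF \<rho>(1)] .
    qed
  next
    case False
    \<comment> \<open>The square is completed by a complex shift: its real part moves the centre to
      \<open>x\<^sub>0\<close>, its imaginary part is the vector \<xi> of the model.\<close>
    define z where "z i = 2 * l i / M" for i
    define x\<^sub>0 \<xi> where "x\<^sub>0 = p - (\<chi> i. Re (z i))" and "\<xi> = (\<chi> i. Im (z i))"
    have zi: "Complex ((x - x\<^sub>0) $ i) (\<xi> $ i) = of_real ((x - p) $ i) + z i" for x i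
      by (simp add: complex_eq_iff x\<^sub>0_def \<xi>_def)
    have q_M: "q x = M / 4 * cdot (cvec (x - x\<^sub>0) \<xi>) (cvec (x - x\<^sub>0) \<xi>)" if "x \<in> U" for x
    proof -
      have "cdot (cvec (x - x\<^sub>0) \<xi>) (cvec (x - x\<^sub>0) \<xi>) = (\<Sum>i\<in>UNIV. (of_real ((x - p) $ i)
          + z i)\<^sup>2)"
        unfolding cdot_def cvec_def vec_lambda_beta zi power2_eq_square ..
      also have "\<dots> = (\<Sum>i\<in>UNIV. of_real ((x - p) $ i) * of_real ((x - p) $ i)
          + 4 / M * (l i * of_real ((x - p) $ i)) + 4 / M\<^sup>2 * (l i)\<^sup>2)"
        using False by (intro sum.cong refl) (simp add: z_def power2_eq_square field_simps)
      also have "\<dots> = of_real ((x - p) \<bullet> (x - p))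
          + 4 / M * (\<Sum>i\<in>UNIV. l i * of_real ((x - p) $ i)) + 4 / M\<^sup>2 * M"
        unfolding sum.distrib sum_distrib_left[symmetric] ll qp by (simp add: inner_vec_def)
      finally have E: "cdot (cvec (x - x\<^sub>0) \<xi>) (cvec (x - x\<^sub>0) \<xi>) = \<dots>" .
      have "x \<in> S" using that U(3) by blast
      show ?thesis
        unfolding E Q[OF \<open>x \<in> S\<close>] qp using False by (simp add: distrib_left power2_eq_square)
    qed
    \<comment> \<open>The phase of \<open>M\<close> becomes the rotation in the model; its modulus
      is a positive factor, invisible to \<open>arg\<close>.\<close>
    define \<theta> where "\<theta> = Arg2pi M"
    have q_eq: "q x = of_real (norm M / 4) * (exp (\<i> * of_real \<theta>) * cdot (cvec (x - x\<^sub>0) \<xi>) (cvec (x - x\<^sub>0) \<xi>))"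
      if "x \<in> U" for x
      unfolding q_M[OF that] by (subst Arg2pi_eq[of M]) (simp add: \<theta>_def)
    have M: "norm M / 4 > 0" using False by simp
    \<comment> \<open>Otherwise \<open>q\<close> is \<open>M\<close> times a real function;
      \<open>q p = 1\<close> forces \<open>M\<close> to be real, and then \<open>q\<close> is real
      on all of \<open>U\<close>.\<close>
    have "\<xi> \<noteq> 0"
    proof
      assume "\<xi> = 0"
      then have r: "q x = M / 4 * of_real ((norm (x - x\<^sub>0))\<^sup>2)" if "x \<in> U" for x
        using q_M[OF that] by (simp add: cdot_cvec_self complex_eq_iff)
      from r[OF U(2)] qp have "M / 4 * of_real ((norm (p - x\<^sub>0))\<^sup>2) = 1" by simp
      then have "Im M * (norm (p - x\<^sub>0))\<^sup>2 = 0" "(norm (p - x\<^sub>0))\<^sup>2 \<noteq> 0"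
        by (auto simp: complex_eq_iff)
      then have "Im M = 0" by simp
      then have "Im (q y) = 0" unfolding r[OF y(1)] by simp
      then show False using not_real by simp
    qed
    show ?thesis
    proof (rule affine_modelI[OF model_weight.arg_quadratic[of \<xi> \<theta>], of "- (1 / \<sigma>)" U x\<^sub>0 \<phi> "\<phi> p"])
      show "\<xi> \<noteq> 0" by fact
      show "0 \<le> \<theta>" "\<theta> < 2 * pi" unfolding \<theta>_def by (rule Arg2pi_ge_0 Arg2pi_lt_2pi)+
      show "- (1 / \<sigma>) \<noteq> 0" using \<sigma> by simp
      fix x assume x: "x \<in> U"
      show "x - x\<^sub>0 \<in> {x. exp (\<i> * of_real \<theta>) * cdot (cvec x \<xi>) (cvec x \<xi>) \<notin> \<real>\<^sub>\<le>\<^sub>0}"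
        using Re_q[OF x] M unfolding q_eq[OF x]
        by (auto simp: complex_nonpos_Reals_iff zero_less_mult_iff)
      show "\<phi> x = - (1 / \<sigma>) * arg (exp (\<i> * of_real \<theta>) * cdot (cvec (x - x\<^sub>0) \<xi>) (cvec (x - x\<^sub>0) \<xi>)) + \<phi> p"
        using arg_q[OF x] unfolding q_eq[OF x] arg_of_real_mult[OF M] .
    qed
  qed
  with U show ?thesis by blast
qed

lemma limiting_carleman_weight_subset:
  "limiting_carleman_weight S \<phi> \<Longrightarrow> T \<subseteq> S \<Longrightarrow> limiting_carleman_weight T \<phi>"
  unfolding limiting_carleman_weight_def using smooth_on_subset by blast

theorem theorem2:
  fixes \<Omega> :: "(real^'n) set" and \<phi> :: "real^'n \<Rightarrow> real"
  assumes "CARD('n) \<ge> 3"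
    and "open \<Omega>"
    and "limiting_carleman_weight \<Omega> \<phi>"
  shows "\<forall>p\<in>\<Omega>. \<exists>U. open U \<and> p \<in> U \<and> U \<subseteq> \<Omega> \<and>
    (\<exists>a b x\<^sub>0 \<phi>\<^sub>0 D. a \<noteq> 0 \<and> model_weight \<phi>\<^sub>0 D \<and>
       (\<forall>x\<in>U. x - x\<^sub>0 \<in> D \<and> \<phi> x = a * \<phi>\<^sub>0 (x - x\<^sub>0) + b))"
proof
  fix p assume "p \<in> \<Omega>"
  then obtain r where r: "r > 0" "ball p r \<subseteq> \<Omega>" using assms(2) openE by blast
  have p: "p \<in> ball p r" using r by simp
  obtain c f k where sys: "carleman_system (ball p r) c \<phi> (diff_covec \<phi>) f k"
    using limiting_carleman_weight_system[OF assms(1) open_ball convex_ball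
        limiting_carleman_weight_subset[OF assms(3) r(2)]] by blast
  consider "c > 0" | "c = 0" | "c < 0" by linarith
  then have "\<exists>U. open U \<and> p \<in> U \<and> U \<subseteq> ball p r \<and> affine_model \<phi> U"
  proof cases
    case 1
    then show ?thesis
      using carleman_system_positive[OF sys open_ball convex_ball p] p open_ball by blast
  next
    case 2
    then show ?thesis
      using carleman_system_zero[OF sys open_ball convex_ball p] p open_ball by blast
  next
    case 3
    then show ?thesis
      by (rule carleman_system_negative[OF sys open_ball convex_ball p])
  qed
  then obtain U where "open U" "p \<in> U" "U \<subseteq> ball p r" "affine_model \<phi> U" by blast
  then show "\<exists>U. open U \<and> p \<in> U \<and> U \<subseteq> \<Omega> \<and>
    (\<exists>a b x\<^sub>0 \<phi>\<^sub>0 D. a \<noteq> 0 \<and> model_weight \<phi>\<^sub>0 D \<and>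
       (\<forall>x\<in>U. x - x\<^sub>0 \<in> D \<and> \<phi> x = a * \<phi>\<^sub>0 (x - x\<^sub>0) + b))"
    using r(2) unfolding affine_model_def by (intro exI[of _ U] conjI) auto
qed

end
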